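(* Let $u\in(C^2(\mathbb{R}^3)\cap L^2(\mathbb{R}^3))^3$ be divergence-free and let $p$ be a (classical) solution of $-\Delta p=\nabla\cdot(u\cdot\nabla u)$ in $\mathbb{R}^3$. Then for every $x\in\mathbb{R}^3$ and $r>0$, $$p(x)=\beta(x,r)+\pi(x,r),$$ where $$\beta(x,r)=\frac1r\int_r^{2r}\overline{p}(x,\rho)\,d\rho$$ and $$\pi(x,r)=\frac{1}{4\pi r}\int_{r\le|y-x|\le 2r}\frac{1}{|y-x|^2}\Big(\frac{y-x}{|y-x|}\cdot(u(y)-u(x))\Big)^2dy+\frac1{4\pi}\int_{|x-y|\le 2r}w\Big(\frac{|y-x|}{r}\Big)\frac{\sigma_{ij}(\widehat{x-y})}{|x-y|^3}(u_i(y)-u_i(x))(u_j(y)-u_j(x))\,dy.$$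
   Context: $\overline{p}(x,\rho)=\fint_{|\xi|=1}p(x+\rho\xi)\,dS(\xi)$ is the spherical average. For $z\ne0$, $\hat z=z/|z|$ and $\sigma_{ij}(\hat z)=3\hat z_i\hat z_j-\delta_{ij}$; summation over repeated indices $i,j=1,2,3$. The weight is $w(\lambda)=1$ for $0\le\lambda\le1$, $w(\lambda)=2-\lambda$ for $1\le\lambda\le2$, $w(\lambda)=0$ for $\lambda\ge2$. *)

theory Defs
  imports "HOL-Analysis.Analysis"
begin

definition C2 :: "('a::real_normed_vector \<Rightarrow> 'b::real_normed_vector) \<Rightarrow> bool" where
  "C2 f \<longleftrightarrow> (\<exists>(D1 :: 'a \<Rightarrow> 'a \<Rightarrow>\<^sub>L 'b) (D2 :: 'a \<Rightarrow> 'a \<Rightarrow>\<^sub>L ('a \<Rightarrow>\<^sub>L 'b)).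
      (\<forall>x. (f has_derivative blinfun_apply (D1 x)) (at x)) \<and>
      (\<forall>x. (D1 has_derivative blinfun_apply (D2 x)) (at x)) \<and>
      continuous_on UNIV D2)"

definition pdiff :: "(real^3 \<Rightarrow> real) \<Rightarrow> 3 \<Rightarrow> real^3 \<Rightarrow> real" where
  "pdiff f i x = frechet_derivative f (at x) (axis i 1)"

definition lap :: "(real^3 \<Rightarrow> real) \<Rightarrow> real^3 \<Rightarrow> real" where
  "lap f x = (\<Sum>i\<in>UNIV. pdiff (\<lambda>y. pdiff f i y) i x)"

definition divg :: "(real^3 \<Rightarrow> real^3) \<Rightarrow> real^3 \<Rightarrow> real" where
  "divg F x = (\<Sum>i\<in>UNIV. pdiff (\<lambda>y. F y $ i) i x)"

definition conv :: "(real^3 \<Rightarrow> real^3) \<Rightarrow> real^3 \<Rightarrow> real^3" where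
  "conv u y = (\<chi> i. \<Sum>j\<in>UNIV. u y $ j * pdiff (\<lambda>z. u z $ i) j y)"

definition sph :: "real \<Rightarrow> real \<Rightarrow> real^3" where
  "sph \<theta> \<phi> = vector [sin \<theta> * cos \<phi>, sin \<theta> * sin \<phi>, cos \<theta>]"

text \<open>Spherical average of p over the sphere of radius rho about x (surface measure
  on the unit sphere = sin theta dtheta dphi, total mass 4 pi).\<close>
definition sph_avg :: "(real^3 \<Rightarrow> real) \<Rightarrow> real^3 \<Rightarrow> real \<Rightarrow> real" where
  "sph_avg p x \<rho> = (1 / (4 * pi)) *
     integral {0..pi} (\<lambda>\<theta>. integral {0..2*pi} (\<lambda>\<phi>. p (x + \<rho> *\<^sub>R sph \<theta> \<phi>) * sin \<theta>))"

definition hat :: "real^3 \<Rightarrow> real^3" where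
  "hat z = z /\<^sub>R norm z"

definition sigma :: "3 \<Rightarrow> 3 \<Rightarrow> real^3 \<Rightarrow> real" where
  "sigma i j z = 3 * z $ i * z $ j - (if i = j then 1 else 0)"

definition wgt :: "real \<Rightarrow> real" where
  "wgt t = (if t \<le> 1 then 1 else if t \<le> 2 then 2 - t else 0)"

definition beta :: "(real^3 \<Rightarrow> real) \<Rightarrow> real^3 \<Rightarrow> real \<Rightarrow> real" where
  "beta p x r = (1 / r) * integral {r..2*r} (\<lambda>\<rho>. sph_avg p x \<rho>)"

definition piterm :: "(real^3 \<Rightarrow> real^3) \<Rightarrow> real^3 \<Rightarrow> real \<Rightarrow> real" where
  "piterm u x r =
     1 / (4 * pi * r) * integral {y. r \<le> norm (y - x) \<and> norm (y - x) \<le> 2 * r}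
        (\<lambda>y. (1 / norm (y - x) ^ 2) * (((y - x) /\<^sub>R norm (y - x)) \<bullet> (u y - u x)) ^ 2)
   + 1 / (4 * pi) * integral {y. norm (x - y) \<le> 2 * r}
        (\<lambda>y. \<Sum>i\<in>UNIV. \<Sum>j\<in>UNIV. wgt (norm (y - x) / r) * sigma i j (hat (x - y)) / norm (x - y) ^ 3
              * (u y $ i - u x $ i) * (u y $ j - u x $ j))"

end

theory Submission
  imports Defs
begin

text \<open>Fix \<open>x\<close>, put \<open>v = u - u(x)\<close>, and let all integrals run over the unit sphere in \<open>\<omega>\<close>. In
  spherical coordinates the divergence theorem on spheres centred at \<open>x\<close> reads
  \<open>(\<rho>\<^sup>2 \<integral> \<omega>\<cdot>F(x+\<rho>\<omega>))' = \<rho>\<^sup>2 \<integral> (div F)(x+\<rho>\<omega>)\<close>. Applied to \<open>\<nabla>p + (u\<cdot>\<nabla>)u\<close>, which is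
  divergence free, and to \<open>((y-x)\<cdot>v) v\<close>, it shows that
  \<open>K(\<rho>) = \<integral> p(x+\<rho>\<omega>) + \<integral> (\<omega>\<cdot>v)\<^sup>2\<close> satisfies \<open>K(0) = 4\<pi> p(x)\<close> and
  \<open>K'(\<rho>) = -(1/\<rho>) \<integral> (3 (\<omega>\<cdot>v)\<^sup>2 - |v|\<^sup>2)\<close>. Integrating the derivative of \<open>w(\<rho>/r) K(\<rho>)\<close>, with
  the weight \<open>w\<close> of the statement, over \<open>[0, 2r]\<close> and passing from polar to volume integrals
  gives the claim; the singularity at \<open>x\<close> is harmless because \<open>v\<close> vanishes there.\<close>

section \<open>Continuously differentiable fields\<close>

text \<open>Continuity is asked for one direction \<open>h\<close> at a time. Since
  \<open>F' y\<close> is linear on a finite-dimensional space, this amounts to continuity of the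
  derivative in operator norm, but it keeps derivatives as plain functions.\<close>

definition C1_deriv :: "(real^3 \<Rightarrow> 'a::real_normed_vector) \<Rightarrow> (real^3 \<Rightarrow> real^3 \<Rightarrow> 'a) \<Rightarrow> bool" where
  "C1_deriv F F' \<longleftrightarrow> (\<forall>y. (F has_derivative F' y) (at y)) \<and> (\<forall>h. continuous_on UNIV (\<lambda>y. F' y h))"

definition tr :: "(real^3 \<Rightarrow> real^3) \<Rightarrow> real" where
  "tr A = (\<Sum>i\<in>UNIV. A (axis i 1) $ i)"

lemma C1_derivD: "C1_deriv F F' \<Longrightarrow> (F has_derivative F' y) (at y)"
  by (simp add: C1_deriv_def)

lemma C1_deriv_linear: "C1_deriv F F' \<Longrightarrow> linear (F' y)"
  using C1_derivD has_derivative_linear by blast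

lemma C1_deriv_continuous:
  assumes "C1_deriv F F'" "continuous_on S f"
  shows "continuous_on S (\<lambda>s. F (f s))"
proof -
  have "continuous_on UNIV F"
    using has_derivative_continuous[OF C1_derivD[OF assms(1)]]
    by (simp add: continuous_at_imp_continuous_on)
  then show ?thesis
    using assms(2) continuous_on_compose2 by blast
qed

lemma linear_expand_axis:
  fixes A :: "real^3 \<Rightarrow> 'a::real_normed_vector"
  assumes "linear A"
  shows "A h = (\<Sum>i\<in>UNIV. h $ i *\<^sub>R A (axis i 1))"
proof -
  have "A h = A (\<Sum>i\<in>UNIV. h $ i *\<^sub>R axis i 1)"
    using basis_expansion[of h] by (simp add: scalar_mult_eq_scaleR)
  also have "\<dots> = (\<Sum>i\<in>UNIV. h $ i *\<^sub>R A (axis i 1))"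
    using assms by (simp add: linear_sum linear_cmul)
  finally show ?thesis .
qed

text \<open>Expanding the direction in the standard basis gives a finite sum of products of
  continuous functions, so base point and direction may vary together.\<close>

lemma C1_deriv_continuous_deriv:
  assumes "C1_deriv F F'" "continuous_on S f" "continuous_on S h"
  shows "continuous_on S (\<lambda>s. F' (f s) (h s))"
proof -
  have "continuous_on S (\<lambda>s. F' (f s) (axis i 1))" for i
    by (rule continuous_on_compose2[OF _ assms(2)]) (use assms(1) in \<open>auto simp: C1_deriv_def\<close>)
  then have "continuous_on S (\<lambda>s. \<Sum>i\<in>UNIV. h s $ i *\<^sub>R F' (f s) (axis i 1))"
    by (intro continuous_intros assms(3))
  then show ?thesis
    by (simp only: linear_expand_axis[OF C1_deriv_linear[OF assms(1)], symmetric])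
qed

lemma C1_deriv_continuous_tr:
  assumes "C1_deriv F F'" "continuous_on S f"
  shows "continuous_on S (\<lambda>s. tr (F' (f s)))"
  unfolding tr_def by (intro continuous_intros C1_deriv_continuous_deriv[OF assms])

lemma C1_deriv_along_line:
  assumes "C1_deriv F F'"
  shows "((\<lambda>t. F (a + t *\<^sub>R b)) has_vector_derivative F' (a + t *\<^sub>R b) b) (at t within T)"
  unfolding has_vector_derivative_def
proof (rule has_derivative_eq_rhs)
  show "((\<lambda>t. F (a + t *\<^sub>R b)) has_derivative (\<lambda>s. F' (a + t *\<^sub>R b) (s *\<^sub>R b))) (at t within T)"
    by (rule has_derivative_compose[OF _ C1_derivD[OF assms]]) (auto intro!: derivative_eq_intros)
  show "(\<lambda>s. F' (a + t *\<^sub>R b) (s *\<^sub>R b)) = (\<lambda>s. s *\<^sub>R F' (a + t *\<^sub>R b) b)"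
    using C1_deriv_linear[OF assms] by (simp add: linear_cmul)
qed

lemma C1_deriv_add:
  "C1_deriv F F' \<Longrightarrow> C1_deriv G G' \<Longrightarrow> C1_deriv (\<lambda>y. F y + G y) (\<lambda>y h. F' y h + G' y h)"
  unfolding C1_deriv_def by (auto intro!: derivative_intros continuous_intros)

lemma C1_deriv_sum:
  assumes "\<And>j. j \<in> J \<Longrightarrow> C1_deriv (F j) (F' j)"
  shows "C1_deriv (\<lambda>y. \<Sum>j\<in>J. F j y) (\<lambda>y h. \<Sum>j\<in>J. F' j y h)"
  using assms unfolding C1_deriv_def by (auto intro!: derivative_intros continuous_intros)

lemma C1_deriv_scaleR:
  fixes f :: "real^3 \<Rightarrow> real"
  assumes f: "C1_deriv f f'" and G: "C1_deriv G G'"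
  shows "C1_deriv (\<lambda>y. f y *\<^sub>R G y) (\<lambda>y h. f y *\<^sub>R G' y h + f' y h *\<^sub>R G y)"
  unfolding C1_deriv_def
proof (intro conjI allI)
  show "((\<lambda>y. f y *\<^sub>R G y) has_derivative (\<lambda>h. f y *\<^sub>R G' y h + f' y h *\<^sub>R G y)) (at y)" for y
    by (rule has_derivative_scaleR[OF C1_derivD[OF f] C1_derivD[OF G]])
  show "continuous_on UNIV (\<lambda>y. f y *\<^sub>R G' y h + f' y h *\<^sub>R G y)" for h
    by (intro continuous_intros C1_deriv_continuous[OF f] C1_deriv_continuous[OF G]
        C1_deriv_continuous_deriv[OF f] C1_deriv_continuous_deriv[OF G])
qed

lemma C1_deriv_inner:
  fixes F G :: "real^3 \<Rightarrow> 'a::euclidean_space"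
  assumes F: "C1_deriv F F'" and G: "C1_deriv G G'"
  shows "C1_deriv (\<lambda>y. F y \<bullet> G y) (\<lambda>y h. F y \<bullet> G' y h + F' y h \<bullet> G y)"
  unfolding C1_deriv_def
proof (intro conjI allI)
  show "((\<lambda>y. F y \<bullet> G y) has_derivative (\<lambda>h. F y \<bullet> G' y h + F' y h \<bullet> G y)) (at y)" for y
    by (rule has_derivative_inner[OF C1_derivD[OF F] C1_derivD[OF G]])
  show "continuous_on UNIV (\<lambda>y. F y \<bullet> G' y h + F' y h \<bullet> G y)" for h
    by (intro continuous_intros C1_deriv_continuous[OF F] C1_deriv_continuous[OF G]
        C1_deriv_continuous_deriv[OF F] C1_deriv_continuous_deriv[OF G])
qed

lemma C1_deriv_diff_const: "C1_deriv F F' \<Longrightarrow> C1_deriv (\<lambda>y. F y - c) F'"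
  unfolding C1_deriv_def by (auto intro!: derivative_eq_intros)

lemma C1_deriv_ident: "C1_deriv (\<lambda>y. y) (\<lambda>y h. h)"
  unfolding C1_deriv_def by (auto intro!: derivative_intros continuous_intros)

lemma C1_deriv_component:
  fixes F :: "real^3 \<Rightarrow> real^'n"
  shows "C1_deriv F F' \<Longrightarrow> C1_deriv (\<lambda>y. F y $ i) (\<lambda>y h. F' y h $ i)"
  unfolding C1_deriv_def
  by (auto intro!: bounded_linear.has_derivative[OF bounded_linear_vec_nth] continuous_intros)

lemma C1_deriv_vec_lambda:
  fixes g :: "'n::finite \<Rightarrow> real^3 \<Rightarrow> real"
  assumes "\<And>i. C1_deriv (g i) (g' i)"
  shows "C1_deriv (\<lambda>y. \<chi> i. g i y) (\<lambda>y h. \<chi> i. g' i y h)"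
  unfolding C1_deriv_def
proof (intro conjI allI)
  show "((\<lambda>y. \<chi> i. g i y) has_derivative (\<lambda>h. \<chi> i. g' i y h)) (at y)" for y
    by (subst has_derivative_componentwise_within)
      (use C1_derivD[OF assms] in \<open>auto simp: Basis_vec_def inner_axis\<close>)
  show "continuous_on UNIV (\<lambda>y. \<chi> i. g' i y h)" for h
    using assms by (auto simp: C1_deriv_def intro!: continuous_intros)
qed

text \<open>Translates bounded-operator derivatives into directional ones. In
  \<open>f'' y k h\<close> the function is differentiated first along \<open>h\<close>, then along
  \<open>k\<close>.\<close>

lemma C2_imp_C1_deriv:
  fixes f :: "real^3 \<Rightarrow> 'b::real_normed_vector"
  assumes "C2 f"
  obtains f' f'' where "C1_deriv f f'" "\<And>h. C1_deriv (\<lambda>y. f' y h) (\<lambda>y k. f'' y k h)"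
proof -
  obtain D1 :: "real^3 \<Rightarrow> (real^3) \<Rightarrow>\<^sub>L 'b" and D2 :: "real^3 \<Rightarrow> (real^3) \<Rightarrow>\<^sub>L ((real^3) \<Rightarrow>\<^sub>L 'b)" where
    D1: "\<And>y. (f has_derivative blinfun_apply (D1 y)) (at y)"
    and D2: "\<And>y. (D1 has_derivative blinfun_apply (D2 y)) (at y)" and c: "continuous_on UNIV D2"
    using assms unfolding C2_def by blast
  have c1: "continuous_on UNIV D1"
    using has_derivative_continuous[OF D2] by (simp add: continuous_at_imp_continuous_on)
  show ?thesis
  proof (rule that)
    show "C1_deriv f (\<lambda>y. blinfun_apply (D1 y))"
      unfolding C1_deriv_def using D1 c1 by (auto intro!: continuous_intros)
    show "C1_deriv (\<lambda>y. blinfun_apply (D1 y) h) (\<lambda>y k. blinfun_apply (blinfun_apply (D2 y) k) h)" for h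
      unfolding C1_deriv_def
      using bounded_linear.has_derivative[OF blinfun.bounded_linear_left D2] c
      by (auto intro!: continuous_intros)
  qed
qed

section \<open>Spherical frame and surface integrals\<close>

text \<open>The unit vectors in the directions of increasing polar angle (\<open>eth\<close>) and
  azimuth (\<open>eph\<close>); together with the radial vector \<open>sph\<close> they form an
  orthonormal frame.\<close>

definition eth :: "real \<Rightarrow> real \<Rightarrow> real^3" where
  "eth \<theta> \<phi> = vector [cos \<theta> * cos \<phi>, cos \<theta> * sin \<phi>, - sin \<theta>]"

definition eph :: "real \<Rightarrow> real^3" where
  "eph \<phi> = vector [- sin \<phi>, cos \<phi>, 0]"

lemma vector_3_eq_axis:
  "(vector [a, b, c] :: real^3) = a *\<^sub>R axis 1 1 + b *\<^sub>R axis 2 1 + c *\<^sub>R axis 3 1"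
  by (simp add: vec_eq_iff forall_3 axis_def)

lemma inner_3: "(a::real^3) \<bullet> b = a$1 * b$1 + a$2 * b$2 + a$3 * b$3"
  by (simp add: inner_vec_def sum_3)

lemma continuous_on_vector_3 [continuous_intros]:
  assumes "continuous_on S f" "continuous_on S g" "continuous_on S h"
  shows "continuous_on S (\<lambda>s. vector [f s, g s, h s] :: real^3)"
  unfolding vector_3_eq_axis by (intro continuous_intros assms)

lemma continuous_on_sph [continuous_intros]:
  fixes f g :: "'a::t2_space \<Rightarrow> real"
  assumes "continuous_on S f" "continuous_on S g"
  shows "continuous_on S (\<lambda>s. sph (f s) (g s))"
  unfolding sph_def by (intro continuous_intros assms)

lemma continuous_on_eth [continuous_intros]:
  fixes f g :: "'a::t2_space \<Rightarrow> real"
  assumes "continuous_on S f" "continuous_on S g"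
  shows "continuous_on S (\<lambda>s. eth (f s) (g s))"
  unfolding eth_def by (intro continuous_intros assms)

lemma continuous_on_eph [continuous_intros]:
  fixes g :: "'a::t2_space \<Rightarrow> real"
  assumes "continuous_on S g"
  shows "continuous_on S (\<lambda>s. eph (g s))"
  unfolding eph_def by (intro continuous_intros assms)

lemma norm_sph [simp]: "norm (sph \<theta> \<phi>) = 1"
proof -
  have "sph \<theta> \<phi> \<bullet> sph \<theta> \<phi> = (sin \<theta>)\<^sup>2 * ((sin \<phi>)\<^sup>2 + (cos \<phi>)\<^sup>2) + (cos \<theta>)\<^sup>2"
    unfolding inner_3 sph_def vector_3 by algebra
  also have "\<dots> = 1"
    by simp
  finally show ?thesis
    by (simp add: norm_eq_1)
qed

text \<open>The trace can be computed in any orthonormal basis, here the spherical frame.\<close>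

lemma tr_spherical_frame:
  assumes "linear A"
  shows "sph \<theta> \<phi> \<bullet> A (sph \<theta> \<phi>) + eth \<theta> \<phi> \<bullet> A (eth \<theta> \<phi>) + eph \<phi> \<bullet> A (eph \<phi>) = tr A"
proof -
  have sc: "(sin \<theta>)\<^sup>2 = 1 - (cos \<theta>)\<^sup>2" "(sin \<phi>)\<^sup>2 = 1 - (cos \<phi>)\<^sup>2"
    by (simp_all add: sin_squared_eq)
  define a where "a i j = A (axis j 1) $ i" for i j
  have A: "A h $ i = h$1 * a i 1 + h$2 * a i 2 + h$3 * a i 3" for h i
    unfolding a_def by (subst linear_expand_axis[OF assms]) (simp add: sum_3)
  have "tr A = a 1 1 + a 2 2 + a 3 3"
    by (simp add: tr_def sum_3 a_def)
  then show ?thesis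
    unfolding inner_3 A sph_def eth_def eph_def vector_3 using sc by algebra
qed

lemma sph_vderiv_theta: "((\<lambda>\<theta>. sph \<theta> \<phi>) has_vector_derivative eth \<theta> \<phi>) (at \<theta> within T)"
  unfolding sph_def eth_def vector_3_eq_axis has_vector_derivative_def
  by (auto intro!: derivative_eq_intros simp: algebra_simps)

lemma sph_vderiv_phi: "((\<lambda>\<phi>. sph \<theta> \<phi>) has_vector_derivative sin \<theta> *\<^sub>R eph \<phi>) (at \<phi> within T)"
  unfolding sph_def eph_def vector_3_eq_axis has_vector_derivative_def
  by (auto intro!: derivative_eq_intros simp: algebra_simps)

lemma eth_vderiv_theta: "((\<lambda>\<theta>. eth \<theta> \<phi>) has_vector_derivative - sph \<theta> \<phi>) (at \<theta> within T)"
  unfolding sph_def eth_def vector_3_eq_axis has_vector_derivative_def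
  by (auto intro!: derivative_eq_intros simp: algebra_simps)

text \<open>The derivative is the horizontal vector pointing towards the polar axis. It is resolved
  along \<open>sph\<close> and \<open>eth\<close> so that its terms combine with those of the
  \<open>\<theta>\<close>-derivative.\<close>

lemma eph_vderiv_phi:
  "(eph has_vector_derivative - (sin \<theta> *\<^sub>R sph \<theta> \<phi> + cos \<theta> *\<^sub>R eth \<theta> \<phi>)) (at \<phi> within T)"
proof -
  have "- (sin \<theta> * (sin \<theta> * c)) - cos \<theta> * (cos \<theta> * c) = - c" for c
    using sin_cos_squared_add[of \<theta>] by algebra
  then have "- (sin \<theta> *\<^sub>R sph \<theta> \<phi> + cos \<theta> *\<^sub>R eth \<theta> \<phi>) = vector [- cos \<phi>, - sin \<phi>, 0]"
    by (simp add: vec_eq_iff forall_3 sph_def eth_def)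
  moreover have "(eph has_vector_derivative vector [- cos \<phi>, - sin \<phi>, 0]) (at \<phi> within T)"
    unfolding eph_def[abs_def] vector_3_eq_axis has_vector_derivative_def
    by (auto intro!: derivative_eq_intros simp: algebra_simps)
  ultimately show ?thesis by simp
qed

lemma C1_deriv_chain_curve:
  assumes "C1_deriv F F'" "(g has_vector_derivative g') (at t within T)"
  shows "((\<lambda>t. F (a + \<rho> *\<^sub>R g t)) has_vector_derivative \<rho> *\<^sub>R F' (a + \<rho> *\<^sub>R g t) g') (at t within T)"
  unfolding has_vector_derivative_def
proof (rule has_derivative_eq_rhs)
  show "((\<lambda>t. F (a + \<rho> *\<^sub>R g t)) has_derivative (\<lambda>s. F' (a + \<rho> *\<^sub>R g t) (\<rho> *\<^sub>R s *\<^sub>R g'))) (at t within T)"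
    by (rule has_derivative_compose[OF _ C1_derivD[OF assms(1)]])
      (use assms(2) in \<open>auto intro!: derivative_eq_intros simp: has_vector_derivative_def\<close>)
  show "(\<lambda>s. F' (a + \<rho> *\<^sub>R g t) (\<rho> *\<^sub>R s *\<^sub>R g')) = (\<lambda>s. s *\<^sub>R \<rho> *\<^sub>R F' (a + \<rho> *\<^sub>R g t) g')"
    using C1_deriv_linear[OF assms(1)] by (simp add: linear_cmul mult.commute)
qed

lemma has_real_derivative_inner:
  fixes f g :: "real \<Rightarrow> 'a::real_inner"
  assumes "(f has_vector_derivative f') (at t within T)" "(g has_vector_derivative g') (at t within T)"
  shows "((\<lambda>t. f t \<bullet> g t) has_real_derivative (f t \<bullet> g' + f' \<bullet> g t)) (at t within T)"
  unfolding has_field_derivative_def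
  by (rule has_derivative_eq_rhs, rule has_derivative_inner)
    (use assms in \<open>auto simp: has_vector_derivative_def algebra_simps\<close>)

section \<open>Integration over the unit sphere and dependence on parameters\<close>

definition sint :: "(real^3 \<Rightarrow> real) \<Rightarrow> real" where
  "sint g = integral (cbox (0,0) (pi, 2*pi)) (\<lambda>(\<theta>,\<phi>). sin \<theta> * g (sph \<theta> \<phi>))"

lemma sint_continuous_integrand:
  assumes "continuous_on UNIV g"
  shows "continuous_on S (\<lambda>(\<theta>,\<phi>). sin \<theta> * g (sph \<theta> \<phi>))"
proof -
  have "continuous_on S (\<lambda>z. g (sph (fst z) (snd z)))"
    by (rule continuous_on_compose2[OF assms]) (auto intro!: continuous_intros)
  then show ?thesis
    unfolding split_beta by (intro continuous_intros)
qed

lemma sint_integrable: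
  assumes "continuous_on UNIV g"
  shows "(\<lambda>(\<theta>,\<phi>). sin \<theta> * g (sph \<theta> \<phi>)) integrable_on cbox (0,0) (pi, 2*pi)"
  by (rule integrable_continuous[OF sint_continuous_integrand[OF assms]])

text \<open>Fubini connects the integral over the parameter rectangle, convenient for linearity and
  for the Leibniz rule, with the iterated form used in \<open>sph_avg\<close>.\<close>

lemma sint_iterated:
  assumes "continuous_on UNIV g"
  shows "sint g = integral {0..pi} (\<lambda>\<theta>. integral {0..2*pi} (\<lambda>\<phi>. g (sph \<theta> \<phi>) * sin \<theta>))"
  unfolding sint_def
  by (subst integral_prod_continuous[OF sint_continuous_integrand[OF assms]]) (simp add: mult.commute)

lemma sint_add:
  assumes "continuous_on UNIV f" "continuous_on UNIV g"
  shows "sint (\<lambda>w. f w + g w) = sint f + sint g"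
  unfolding sint_def
  using integral_add[OF sint_integrable[OF assms(1)] sint_integrable[OF assms(2)]]
  by (simp only: case_prod_unfold distrib_left)

lemma sint_cmult: "sint (\<lambda>w. c * g w) = c * sint g"
  unfolding sint_def case_prod_unfold integral_mult_right[symmetric] by (simp only: mult.left_commute)

lemma sint_diff:
  assumes "continuous_on UNIV f" "continuous_on UNIV g"
  shows "sint (\<lambda>w. f w - g w) = sint f - sint g"
  using sint_add[of f "\<lambda>w. -1 * g w"] sint_cmult[of "-1" g] assms by (simp add: continuous_on_minus)

lemma sint_cong:
  assumes "\<And>w. norm w = 1 \<Longrightarrow> f w = g w"
  shows "sint f = sint g"
  unfolding sint_def using assms by simp

lemma sint_const: "sint (\<lambda>w. c) = 4 * pi * c"
proof -
  have "((\<lambda>\<theta>. 2 * pi * c * sin \<theta>) has_integral (- 2*pi*c*cos pi - (- 2*pi*c*cos 0))) {0..pi}"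
    by (intro fundamental_theorem_of_calculus)
      (auto intro!: derivative_eq_intros simp flip: has_real_derivative_iff_has_vector_derivative)
  then have "integral {0..pi} (\<lambda>\<theta>. 2 * pi * c * sin \<theta>) = 4 * pi * c"
    by (simp add: integral_unique)
  then show ?thesis
    by (subst sint_iterated) (auto simp: mult_ac)
qed

lemma sint_continuous_param:
  fixes f :: "'a::t2_space \<Rightarrow> real^3 \<Rightarrow> real"
  assumes "continuous_on (T \<times> UNIV) (\<lambda>(t,w). f t w)"
  shows "continuous_on T (\<lambda>t. sint (f t))"
  unfolding sint_def
proof (rule integral_continuous_on_param)
  have "continuous_on (T \<times> cbox (0,0) (pi,2*pi)) (\<lambda>z. (\<lambda>(t,w). f t w) (fst z, sph (fst (snd z)) (snd (snd z))))"
    by (rule continuous_on_compose2[OF assms]) (auto intro!: continuous_intros)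
  then show "continuous_on (T \<times> cbox (0,0) (pi,2*pi)) (\<lambda>(t, \<theta>, \<phi>). sin \<theta> * f t (sph \<theta> \<phi>))"
    unfolding split_beta by (auto intro!: continuous_intros)
qed

lemma sint_has_derivative_param:
  assumes "\<And>t w. ((\<lambda>t. f t w) has_real_derivative f' t w) (at t)"
    and "\<And>t. continuous_on UNIV (f t)"
    and "continuous_on UNIV (\<lambda>(t,w). f' t w)"
  shows "((\<lambda>t. sint (f t)) has_real_derivative sint (f' t)) (at t)"
  unfolding sint_def
proof (rule leibniz_rule_field_derivative)
  show "((\<lambda>t. (case z of (\<theta>,\<phi>) \<Rightarrow> sin \<theta> * f t (sph \<theta> \<phi>))) has_real_derivative
      (case z of (\<theta>,\<phi>) \<Rightarrow> sin \<theta> * f' t (sph \<theta> \<phi>))) (at t)" for t z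
    by (auto simp: split_beta intro!: derivative_eq_intros assms(1))
  show "(\<lambda>(\<theta>,\<phi>). sin \<theta> * f t (sph \<theta> \<phi>)) integrable_on cbox (0,0) (pi,2*pi)" for t
    by (rule sint_integrable[OF assms(2)])
  have "continuous_on (UNIV \<times> cbox (0,0) (pi,2*pi)) (\<lambda>z. (\<lambda>(t,w). f' t w) (fst z, sph (fst (snd z)) (snd (snd z))))"
    by (rule continuous_on_compose2[OF assms(3)]) (auto intro!: continuous_intros)
  then show "continuous_on (UNIV \<times> cbox (0,0) (pi,2*pi)) (\<lambda>(t, \<theta>, \<phi>). sin \<theta> * f' t (sph \<theta> \<phi>))"
    unfolding split_beta by (auto intro!: continuous_intros)
qed auto

section \<open>Divergence theorem on spheres\<close>

text \<open>The angular part of \<open>div F\<close> is a sum of a \<open>\<theta>\<close>-derivative and a \<open>\<phi>\<close>-derivative, and both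
  boundary terms vanish.\<close>
lemma sint_divergence_angular:
  assumes F: "C1_deriv F F'"
  shows "sint (\<lambda>w. \<rho> * (tr (F' (x + \<rho> *\<^sub>R w)) - w \<bullet> F' (x + \<rho> *\<^sub>R w) w) - 2 * (w \<bullet> F (x + \<rho> *\<^sub>R w))) = 0"
proof -
  let ?y = "\<lambda>\<theta> \<phi>. x + \<rho> *\<^sub>R sph \<theta> \<phi>"
  \<comment> \<open>This is the \<open>\<theta>\<close>-derivative of
    \<open>sin \<theta> * (eth \<theta> \<phi> \<bullet> F)\<close>, and \<open>b\<close> below is
    the \<open>\<phi>\<close>-derivative of \<open>eph \<phi> \<bullet> F\<close>.\<close>
  define a where "a \<theta> \<phi> = sin \<theta> * (eth \<theta> \<phi> \<bullet> \<rho> *\<^sub>R F' (?y \<theta> \<phi>) (eth \<theta> \<phi>) - sph \<theta> \<phi> \<bullet> F (?y \<theta> \<phi>)) +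
      cos \<theta> * (eth \<theta> \<phi> \<bullet> F (?y \<theta> \<phi>))" for \<theta> \<phi>
  define b where "b \<theta> \<phi> = eph \<phi> \<bullet> \<rho> *\<^sub>R F' (?y \<theta> \<phi>) (sin \<theta> *\<^sub>R eph \<phi>)
      - (sin \<theta> *\<^sub>R sph \<theta> \<phi> + cos \<theta> *\<^sub>R eth \<theta> \<phi>) \<bullet> F (?y \<theta> \<phi>)" for \<theta> \<phi>
  have ac: "continuous_on S (\<lambda>(\<theta>,\<phi>). a \<theta> \<phi>)" for S
    unfolding a_def split_beta
    by (intro continuous_intros C1_deriv_continuous[OF F] C1_deriv_continuous_deriv[OF F])
  have bc: "continuous_on S (\<lambda>(\<theta>,\<phi>). b \<theta> \<phi>)" for S
    unfolding b_def split_beta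
    by (intro continuous_intros C1_deriv_continuous[OF F] C1_deriv_continuous_deriv[OF F])
  have a0: "integral {0..pi} (\<lambda>\<theta>. a \<theta> \<phi>) = 0" for \<phi>
  proof -
    \<comment> \<open>The boundary terms vanish because \<open>sin\<close> is zero at both
      poles.\<close>
    have "((\<lambda>\<theta>. a \<theta> \<phi>) has_integral (sin pi * (eth pi \<phi> \<bullet> F (?y pi \<phi>)) - sin 0 * (eth 0 \<phi> \<bullet> F (?y 0 \<phi>)))) {0..pi}"
    proof (intro fundamental_theorem_of_calculus)
      fix \<theta> assume "\<theta> \<in> {0..pi}"
      show "((\<lambda>\<theta>. sin \<theta> * (eth \<theta> \<phi> \<bullet> F (?y \<theta> \<phi>))) has_vector_derivative a \<theta> \<phi>) (at \<theta> within {0..pi})"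
        unfolding has_real_derivative_iff_has_vector_derivative[symmetric]
        by (rule DERIV_cong[OF DERIV_mult[OF _ has_real_derivative_inner[OF eth_vderiv_theta C1_deriv_chain_curve[OF F sph_vderiv_theta]]]])
          (auto intro!: derivative_eq_intros simp: a_def algebra_simps)
    qed simp
    then show ?thesis
      by (simp add: integral_unique)
  qed
  have b0: "integral {0..2*pi} (\<lambda>\<phi>. b \<theta> \<phi>) = 0" for \<theta>
  proof -
    \<comment> \<open>The boundary terms cancel by periodicity in the azimuth.\<close>
    have "((\<lambda>\<phi>. b \<theta> \<phi>) has_integral ((eph (2*pi) \<bullet> F (?y \<theta> (2*pi))) - (eph 0 \<bullet> F (?y \<theta> 0)))) {0..2*pi}"
    proof (intro fundamental_theorem_of_calculus)
      fix \<phi> assume "\<phi> \<in> {0..2*pi}"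
      show "((\<lambda>\<phi>. (eph \<phi> \<bullet> F (?y \<theta> \<phi>))) has_vector_derivative b \<theta> \<phi>) (at \<phi> within {0..2*pi})"
        unfolding has_real_derivative_iff_has_vector_derivative[symmetric]
        by (rule DERIV_cong[OF has_real_derivative_inner[OF eph_vderiv_phi C1_deriv_chain_curve[OF F sph_vderiv_phi]]])
          (auto simp: b_def algebra_simps)
    qed simp
    then show ?thesis
      by (simp add: integral_unique eph_def sph_def)
  qed
  \<comment> \<open>The order of integration is exchanged so that the
    \<open>\<theta>\<close>-integral, which is zero, becomes the inner one.\<close>
  have "integral (cbox (0,0) (pi,2*pi)) (\<lambda>(\<theta>,\<phi>). a \<theta> \<phi>) = integral {0..2*pi} (\<lambda>\<phi>. integral {0..pi} (\<lambda>\<theta>. a \<theta> \<phi>))"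
    using integral_swap_continuous[OF ac, of 0 pi 0 "2*pi"] 
    unfolding integral_prod_continuous[OF ac] by simp
  then have A: "integral (cbox (0,0) (pi,2*pi)) (\<lambda>(\<theta>,\<phi>). a \<theta> \<phi>) = 0"
    by (simp add: a0)
  have B: "integral (cbox (0,0) (pi,2*pi)) (\<lambda>(\<theta>,\<phi>). b \<theta> \<phi>) = 0"
    by (simp add: integral_prod_continuous[OF bc] b0)
  \<comment> \<open>The two \<open>cos \<theta>\<close> terms cancel, each of \<open>a\<close> and
    \<open>b\<close> contributes one radial term, and the frame formula supplies the trace without
    its radial part.\<close>
  have "a \<theta> \<phi> + b \<theta> \<phi> = sin \<theta> * (\<rho> * (tr (F' (?y \<theta> \<phi>)) - sph \<theta> \<phi> \<bullet> F' (?y \<theta> \<phi>) (sph \<theta> \<phi>)) - 2 * (sph \<theta> \<phi> \<bullet> F (?y \<theta> \<phi>)))" for \<theta> \<phi>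
    unfolding tr_spherical_frame[OF C1_deriv_linear[OF F], where \<theta>=\<theta> and \<phi>=\<phi>, symmetric] a_def b_def
    by (simp add: linear_cmul[OF C1_deriv_linear[OF F]] algebra_simps)
  then have "sint (\<lambda>w. \<rho> * (tr (F' (x + \<rho> *\<^sub>R w)) - w \<bullet> F' (x + \<rho> *\<^sub>R w) w) - 2 * (w \<bullet> F (x + \<rho> *\<^sub>R w)))
     = integral (cbox (0,0) (pi,2*pi)) (\<lambda>z. (\<lambda>(\<theta>,\<phi>). a \<theta> \<phi>) z + (\<lambda>(\<theta>,\<phi>). b \<theta> \<phi>) z)"
    unfolding sint_def by (intro integral_cong) auto
  also have "\<dots> = 0"
    by (subst integral_add) (auto intro!: integrable_continuous ac bc simp: A B)
  finally show ?thesis .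
qed

text \<open>The product rule yields \<open>2 * \<rho>\<close> times the flux integral plus a radial
  derivative; the angular identity, multiplied by \<open>\<rho>\<close>, turns this sum into the
  integral of the divergence. It holds for every real \<open>\<rho>\<close>, so fluxes can be
  compared with the value at \<open>\<rho> = 0\<close>.\<close>

lemma flux_has_derivative:
  assumes F: "C1_deriv F F'"
  shows "((\<lambda>\<rho>. \<rho>\<^sup>2 * sint (\<lambda>w. w \<bullet> F (x + \<rho> *\<^sub>R w))) has_real_derivative
      \<rho>\<^sup>2 * sint (\<lambda>w. tr (F' (x + \<rho> *\<^sub>R w)))) (at \<rho>)"
proof -
  note cont = continuous_intros C1_deriv_continuous[OF F] C1_deriv_continuous_deriv[OF F] C1_deriv_continuous_tr[OF F]
  have "((\<lambda>\<rho>. sint (\<lambda>w. w \<bullet> F (x + \<rho> *\<^sub>R w))) has_real_derivative sint (\<lambda>w. w \<bullet> F' (x + \<rho> *\<^sub>R w) w)) (at \<rho>)"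
  proof (rule sint_has_derivative_param)
    show "((\<lambda>t. w \<bullet> F (x + t *\<^sub>R w)) has_real_derivative w \<bullet> F' (x + t *\<^sub>R w) w) (at t)" for t w
      using has_real_derivative_inner[OF has_vector_derivative_const C1_deriv_along_line[OF F]] by simp
    show "continuous_on UNIV (\<lambda>w. w \<bullet> F (x + t *\<^sub>R w))" for t
      by (intro cont)
    show "continuous_on UNIV (\<lambda>(t, w). w \<bullet> F' (x + t *\<^sub>R w) w)"
      unfolding case_prod_unfold by (intro cont)
  qed
  then have "((\<lambda>\<rho>. \<rho>\<^sup>2 * sint (\<lambda>w. w \<bullet> F (x + \<rho> *\<^sub>R w))) has_real_derivative
      2 * \<rho> * sint (\<lambda>w. w \<bullet> F (x + \<rho> *\<^sub>R w)) + \<rho>\<^sup>2 * sint (\<lambda>w. w \<bullet> F' (x + \<rho> *\<^sub>R w) w)) (at \<rho>)"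
    by (auto intro!: derivative_eq_intros)
  moreover have "\<rho> * (sint (\<lambda>w. tr (F' (x + \<rho> *\<^sub>R w))) - sint (\<lambda>w. w \<bullet> F' (x + \<rho> *\<^sub>R w) w))
      - 2 * sint (\<lambda>w. w \<bullet> F (x + \<rho> *\<^sub>R w)) = 0"
    unfolding sint_divergence_angular[OF F, of \<rho> x, symmetric]
    by (subst sint_diff, intro cont, intro cont, subst sint_cmult, subst sint_cmult, subst sint_diff, intro cont, intro cont, rule refl)
  then have "2 * \<rho> * sint (\<lambda>w. w \<bullet> F (x + \<rho> *\<^sub>R w)) + \<rho>\<^sup>2 * sint (\<lambda>w. w \<bullet> F' (x + \<rho> *\<^sub>R w) w)
      = \<rho>\<^sup>2 * sint (\<lambda>w. tr (F' (x + \<rho> *\<^sub>R w)))"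
    by algebra
  ultimately show ?thesis
    by simp
qed

section \<open>Volume integrals in polar coordinates\<close>

lemma cbox_triple: "cbox (a, c, e) (b, d, f) = cbox a b \<times> cbox c d \<times> cbox e f"
  by (simp add: cbox_Pair_eq)

lemma vector_image_cbox:
  "(\<lambda>(r, s, t). vector [r, s, t] :: real^3) ` cbox (a1, a2, a3) (b1, b2, b3) = cbox (vector [a1, a2, a3]) (vector [b1, b2, b3])"
proof -
  have "z = (\<lambda>(r, s, t). vector [r, s, t]) (z$1, z$2, z$3)" for z :: "real^3"
    by (simp add: vec_eq_iff forall_3)
  then show ?thesis
    by (fastforce simp: cbox_triple mem_box_cart forall_3 image_iff)
qed

text \<open>The change of variables takes place in \<open>real^3\<close>, while Fubini is applied on
  a product type. Regrouping coordinates maps boxes to boxes of the same content, so integrals agree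
  with factor 1.\<close>

lemma integral_cbox_vec3:
  fixes H :: "real^3 \<Rightarrow> real"
  assumes "continuous_on (cbox (vector [a1, a2, a3]) (vector [b1, b2, b3])) H"
  shows "integral (cbox (vector [a1, a2, a3]) (vector [b1, b2, b3])) H =
    integral (cbox (a1, a2, a3) (b1, b2, b3)) (\<lambda>(r, s, t). H (vector [r, s, t]))"
proof -
  let ?g = "\<lambda>(r, s, t). vector [r, s, t] :: real^3"
  let ?h = "\<lambda>z::real^3. (z$1, z$2, z$3)"
  have hg: "?h (?g p) = p" for p
    by (simp add: case_prod_unfold)
  have gh: "?g (?h z) = z" for z
    by (simp add: vec_eq_iff forall_3)
  have himg: "?h ` cbox u v = cbox (u$1, u$2, u$3) (v$1, v$2, v$3)" for u v :: "real^3"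
  proof -
    have "cbox u v = ?g ` cbox (u$1, u$2, u$3) (v$1, v$2, v$3)"
      unfolding vector_image_cbox using gh[of u] gh[of v] by simp
    then show ?thesis
      by (simp only: image_image hg image_ident)
  qed
  have "((\<lambda>p. H (?g p)) has_integral (1/1) *\<^sub>R integral (cbox (vector [a1, a2, a3]) (vector [b1, b2, b3])) H)
    (?h ` cbox (vector [a1, a2, a3]) (vector [b1, b2, b3]))"
  proof (rule has_integral_twiddle[of 1 ?h ?g])
    show "isCont ?g p" for p
    proof -
      have "continuous_on UNIV ?g"
        unfolding case_prod_unfold by (intro continuous_intros)
      then show ?thesis
        using continuous_on_eq_continuous_at open_UNIV by blast
    qed
    show "\<exists>w z. ?g ` cbox u v = cbox w z" for u v
      using vector_image_cbox by (metis prod_cases3)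
    show "\<exists>w z. ?h ` cbox u v = cbox w z" for u v
      using himg by blast
    show "measure lborel (?g ` cbox u v) = 1 * measure lborel (cbox u v)" for u v
    proof -
      obtain a1 a2 a3 b1 b2 b3 where uv: "u = (a1, a2, a3)" "v = (b1, b2, b3)"
        by (metis prod_cases3)
      have UNIV3: "prod q (UNIV::3 set) = q 1 * q 2 * q 3" for q :: "3 \<Rightarrow> real"
        unfolding UNIV_3 by (simp add: mult.assoc)
      have ne: "cbox (vector [a1, a2, a3] :: real^3) (vector [b1, b2, b3]) = {} \<longleftrightarrow> \<not> (a1 \<le> b1 \<and> a2 \<le> b2 \<and> a3 \<le> b3)"
        using interval_ne_empty_cart(1)[of "vector [a1, a2, a3] :: real^3" "vector [b1, b2, b3]"]
        unfolding forall_3 vector_3 by argo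
      show ?thesis
        unfolding uv vector_image_cbox content_cbox_if_cart ne UNIV3 content_Pair by auto
    qed
    show "(H has_integral integral (cbox (vector [a1, a2, a3]) (vector [b1, b2, b3])) H) (cbox (vector [a1, a2, a3]) (vector [b1, b2, b3]))"
      using integrable_continuous[OF assms] by (simp add: integrable_integral)
  qed (use hg gh in auto)
  then show ?thesis
    unfolding himg vector_3 by (simp add: case_prod_unfold integral_unique)
qed

lemma negligible_coordinate_plane: "negligible {z::real^3. z$i = c}"
  using negligible_standard_hyperplane[of "axis i 1 :: real^3" c] by (simp add: inner_axis axis_in_Basis_iff)

section \<open>The spherical coordinate map and its Jacobian\<close>

definition sphmap :: "real^3 \<Rightarrow> real^3 \<Rightarrow> real^3" where
  "sphmap x z = x + z$1 *\<^sub>R sph (z$2) (z$3)"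

text \<open>The derivative of \<open>sphmap x\<close> at \<open>z\<close>, with the partial
  derivatives along radius, polar angle and azimuth written in the spherical frame.\<close>

definition sphmap' :: "real^3 \<Rightarrow> real^3 \<Rightarrow> real^3" where
  "sphmap' z h = h$1 *\<^sub>R sph (z$2) (z$3) + z$1 *\<^sub>R (h$2 *\<^sub>R eth (z$2) (z$3) + (h$3 * sin (z$2)) *\<^sub>R eph (z$3))"

lemma sphmap_has_derivative: "(sphmap x has_derivative sphmap' z) (at z within S)"
proof -
  have d: "((\<lambda>z::real^3. z$i) has_derivative (\<lambda>h. h$i)) (at z within S)" for i
    by (rule bounded_linear_imp_has_derivative[OF bounded_linear_vec_nth])
  show ?thesis
    unfolding sphmap_def[abs_def] sph_def vector_3_eq_axis
    by (rule has_derivative_eq_rhs, (rule derivative_intros d refl)+)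
      (simp add: fun_eq_iff sphmap'_def sph_def eth_def eph_def vec_eq_iff forall_3 axis_def algebra_simps)
qed

text \<open>The columns are orthogonal and positively oriented, of signed lengths \<open>1\<close>,
  \<open>\<rho>\<close> and \<open>\<rho> * sin \<theta>\<close>.\<close>

lemma det_sphmap': "det (matrix (sphmap' z)) = (z$1)\<^sup>2 * sin (z$2)"
proof -
  have sc: "(sin (z$2))\<^sup>2 = 1 - (cos (z$2))\<^sup>2" "(sin (z$3))\<^sup>2 = 1 - (cos (z$3))\<^sup>2"
    by (simp_all add: sin_squared_eq)
  have m: "matrix (sphmap' z) $ i $ j = sphmap' z (axis j 1) $ i" for i j
    by (simp add: matrix_def)
  show ?thesis
    using sc by (simp add: det_3 m sphmap'_def axis_def sph_def eth_def eph_def) algebra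
qed

text \<open>The norm recovers the radius, \<open>cos\<close> is injective on the polar range, and
  dividing by the positive \<open>sin (z$2)\<close> leaves sine and cosine of the azimuth, which fix
  it within an open interval of length \<open>2 * pi\<close>.\<close>

lemma sphmap_inj: "inj_on (sphmap x) {z. 0 < z$1 \<and> 0 < z$2 \<and> z$2 < pi \<and> 0 < z$3 \<and> z$3 < 2*pi}"
proof (rule inj_onI, clarsimp)
  fix z z' :: "real^3"
  assume eq: "sphmap x z = sphmap x z'"
    and z: "0 < z$1" "0 < z$2" "z$2 < pi" "0 < z$3" "z$3 < 2*pi"
    and z': "0 < z'$1" "0 < z'$2" "z'$2 < pi" "0 < z'$3" "z'$3 < 2*pi"
  have "norm (sphmap x z - x) = z$1" "norm (sphmap x z' - x) = z'$1"
    using z z' by (simp_all add: sphmap_def)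
  with eq have e1: "z$1 = z'$1"
    by simp
  with eq z have "sph (z$2) (z$3) = sph (z'$2) (z'$3)"
    by (simp add: sphmap_def)
  then have c: "cos (z$2) = cos (z'$2)" and s: "sin (z$2) * cos (z$3) = sin (z'$2) * cos (z'$3)"
    "sin (z$2) * sin (z$3) = sin (z'$2) * sin (z'$3)"
    by (simp_all add: vec_eq_iff forall_3 sph_def)
  from c have e2: "z$2 = z'$2"
    using z z' by (simp add: cos_inj_pi)
  moreover have "sin (z$2) > 0"
    using z by (simp add: sin_gt_zero)
  ultimately have "cos (z$3) = cos (z'$3)" "sin (z$3) = sin (z'$3)"
    using s by auto
  then obtain n :: int where n: "z$3 = z'$3 + 2 * pi * n"
    using sin_cos_eq_iff by blast
  then have "\<bar>2 * pi * real_of_int n\<bar> < 2 * pi * 1"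
    using z z' by linarith
  then have "\<bar>real_of_int n\<bar> < 1"
    by (simp add: abs_mult)
  then have "n = 0"
    by linarith
  with n have "z$3 = z'$3"
    by simp
  with e1 e2 show "z = z'"
    by (simp add: vec_eq_iff forall_3)
qed

text \<open>A nonzero second coordinate keeps \<open>d\<close> off the polar axis and off the
  half-plane of azimuth 0, so the open parameter range suffices. The excluded plane is a null
  set.\<close>

lemma spherical_coordinates_exist:
  fixes d :: "real^3"
  assumes "d$2 \<noteq> 0"
  obtains \<theta> \<phi> where "0 < \<theta>" "\<theta> < pi" "0 < \<phi>" "\<phi> < 2*pi" "d = norm d *\<^sub>R sph \<theta> \<phi>"
proof -
  define e where "e = d /\<^sub>R norm d"
  have nd: "norm d > 0"
    using assms by auto
  then have "norm e = 1" and e2: "e$2 \<noteq> 0"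
    using assms by (auto simp: e_def)
  then have "e \<bullet> e = 1"
    by (simp add: norm_eq_1)
  then have e: "(e$1)\<^sup>2 + (e$2)\<^sup>2 + (e$3)\<^sup>2 = 1"
    by (simp add: inner_3 power2_eq_square)
  \<comment> \<open>The distance of \<open>e\<close> from the polar axis, which becomes
    \<open>sin \<theta>\<close>.\<close>
  define s where "s = sqrt ((e$1)\<^sup>2 + (e$2)\<^sup>2)"
  have s: "s > 0" "s\<^sup>2 = (e$1)\<^sup>2 + (e$2)\<^sup>2"
    using e2 by (auto simp: s_def add_nonneg_pos)
  obtain \<theta> where \<theta>: "0 \<le> \<theta>" "\<theta> \<le> pi" "e$3 = cos \<theta>" "s = sin \<theta>"
    using sincos_total_pi[of s "e$3"] s e by auto
  have "(e$1 / s)\<^sup>2 + (e$2 / s)\<^sup>2 = 1"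
    using s e2 by (simp add: power_divide flip: add_divide_distrib)
  then obtain \<phi> where \<phi>: "0 \<le> \<phi>" "\<phi> < 2*pi" "e$1 / s = cos \<phi>" "e$2 / s = sin \<phi>"
    by (rule sincos_total_2pi)
  have "\<theta> \<noteq> 0" "\<theta> \<noteq> pi" "\<phi> \<noteq> 0"
    using \<theta> \<phi> s e2 by auto
  moreover have "e = sph \<theta> \<phi>"
    using \<theta> \<phi> s by (simp add: vec_eq_iff forall_3 sph_def field_simps)
  then have "d = norm d *\<^sub>R sph \<theta> \<phi>"
    using nd by (simp flip: \<open>e = sph \<theta> \<phi>\<close> add: e_def)
  ultimately show ?thesis
    using that \<theta> \<phi> by (simp add: less_le)
qed

text \<open>The cited change of variables theorem concerns vector values, so a real function is
  passed through \<open>real^1\<close>.\<close>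

lemma integral_change_of_variables_real:
  fixes f :: "real^3 \<Rightarrow> real" and g :: "real^3 \<Rightarrow> real^3"
  assumes "S \<in> sets lebesgue" "\<And>x. x \<in> S \<Longrightarrow> (g has_derivative g' x) (at x within S)" "inj_on g S"
    and "(\<lambda>x. \<bar>det (matrix (g' x))\<bar> * f (g x)) absolutely_integrable_on S"
  shows "integral (g ` S) f = integral S (\<lambda>x. \<bar>det (matrix (g' x))\<bar> * f (g x))"
proof -
  have "(\<lambda>x. \<bar>det (matrix (g' x))\<bar> *\<^sub>R (vec (f (g x)) :: real^1)) absolutely_integrable_on S"
    using assms(4) by (simp add: absolutely_integrable_on_1_iff)
  then have "integral (g ` S) (\<lambda>y. vec (f y) :: real^1) = integral S (\<lambda>x. \<bar>det (matrix (g' x))\<bar> *\<^sub>R (vec (f (g x)) :: real^1))"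
    using has_absolute_integral_change_of_variables[OF assms(1-3), where f="\<lambda>y. vec (f y) :: real^1"] by blast
  then show ?thesis
    by (simp add: integral_on_1_eq vec_eq_iff)
qed

text \<open>Continuity is required of the pulled-back integrand including the factor
  \<open>\<rho>\<^sup>2\<close>, not of \<open>f\<close>, so \<open>f\<close> may be singular at
  \<open>x\<close>. Null sets on which the coordinates degenerate are removed before changing
  variables; Fubini then separates the radius.\<close>

lemma integral_polar:
  fixes f :: "real^3 \<Rightarrow> real"
  assumes "0 \<le> a"
    and cont: "continuous_on (cbox (a, 0, 0) (b, pi, 2*pi)) (\<lambda>(\<rho>, \<theta>, \<phi>). sin \<theta> * (\<rho>\<^sup>2 * f (x + \<rho> *\<^sub>R sph \<theta> \<phi>)))"
  shows "integral {y. a \<le> norm (y - x) \<and> norm (y - x) \<le> b} f = integral {a..b} (\<lambda>\<rho>. sint (\<lambda>w. \<rho>\<^sup>2 * f (x + \<rho> *\<^sub>R w)))"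
proof -
  define B :: "(real^3) set" where "B = cbox (vector [a, 0, 0]) (vector [b, pi, 2*pi])"
  define N :: "(real^3) set" where "N = {z. z$1 = 0} \<union> {z. z$2 = 0} \<union> {z. z$2 = pi} \<union> {z. z$3 = 0} \<union> {z. z$3 = 2*pi}"
  define A where "A = {y. a \<le> norm (y - x) \<and> norm (y - x) \<le> b}"
  define H where "H z = (z$1)\<^sup>2 * sin (z$2) * f (sphmap x z)" for z :: "real^3"
  have N: "negligible N"
    unfolding N_def by (intro negligible_Un negligible_coordinate_plane)
  have SB: "z \<in> B - N \<longleftrightarrow> a \<le> z$1 \<and> z$1 \<le> b \<and> 0 < z$1 \<and> 0 < z$2 \<and> z$2 < pi \<and> 0 < z$3 \<and> z$3 < 2*pi" for z
    using assms(1) by (auto simp: B_def N_def mem_box_cart forall_3)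
  have "continuous_on B (\<lambda>z. (\<lambda>(\<rho>, \<theta>, \<phi>). sin \<theta> * (\<rho>\<^sup>2 * f (x + \<rho> *\<^sub>R sph \<theta> \<phi>))) (z$1, z$2, z$3))"
    by (rule continuous_on_compose2[OF cont]) (auto intro!: continuous_intros simp: B_def mem_box_cart forall_3 cbox_triple)
  then have HB: "continuous_on B H"
    by (rule continuous_on_eq) (simp add: H_def sphmap_def)
  have "H absolutely_integrable_on B"
    unfolding B_def by (rule absolutely_integrable_continuous) (use HB in \<open>simp add: B_def\<close>)
  moreover have neg: "negligible {z \<in> B - (B - N). H z \<noteq> 0}" "negligible {z \<in> (B - N) - B. H z \<noteq> 0}"
    by (auto intro: negligible_subset[OF N])
  ultimately have HS: "H absolutely_integrable_on (B - N)"
    using absolutely_integrable_spike_set_eq by blast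
  have det: "\<bar>det (matrix (sphmap' z))\<bar> * f (sphmap x z) = H z" if "z \<in> B - N" for z
  proof -
    have "sin (z$2) \<ge> 0"
      using that SB[of z] by (intro sin_ge_zero) auto
    then show ?thesis
      by (simp add: det_sphmap' H_def abs_mult)
  qed
  have "integral (sphmap x ` (B - N)) f = integral (B - N) (\<lambda>z. \<bar>det (matrix (sphmap' z))\<bar> * f (sphmap x z))"
  proof (rule integral_change_of_variables_real)
    show "B - N \<in> sets lebesgue"
      using N by (auto simp: B_def negligible_iff_null_sets)
    show "(sphmap x has_derivative sphmap' z) (at z within B - N)" for z
      by (rule sphmap_has_derivative)
    show "inj_on (sphmap x) (B - N)"
      by (rule inj_on_subset[OF sphmap_inj]) (use SB in blast)
    show "(\<lambda>z. \<bar>det (matrix (sphmap' z))\<bar> * f (sphmap x z)) absolutely_integrable_on (B - N)"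
      by (rule absolutely_integrable_spike[OF HS negligible_empty]) (simp only: det Diff_empty)
  qed
  also have "\<dots> = integral (B - N) H"
    by (rule integral_cong) (rule det)
  also have "\<dots> = integral B H"
    by (rule integral_spike_set) (use neg in auto)
  also have "\<dots> = integral (cbox (a, 0, 0) (b, pi, 2*pi)) (\<lambda>(r, s, t). H (vector [r, s, t]))"
    unfolding B_def by (rule integral_cbox_vec3) (use HB in \<open>simp add: B_def\<close>)
  also have "\<dots> = integral (cbox (a, 0, 0) (b, pi, 2*pi)) (\<lambda>(\<rho>, \<theta>, \<phi>). sin \<theta> * (\<rho>\<^sup>2 * f (x + \<rho> *\<^sub>R sph \<theta> \<phi>)))"
    by (rule integral_cong) (auto simp: H_def sphmap_def)
  also have "\<dots> = integral (cbox a b) (\<lambda>\<rho>. sint (\<lambda>w. \<rho>\<^sup>2 * f (x + \<rho> *\<^sub>R w)))"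
    unfolding sint_def by (subst integral_prod_continuous[OF cont]) simp
  finally have 1: "integral (sphmap x ` (B - N)) f = integral {a..b} (\<lambda>\<rho>. sint (\<lambda>w. \<rho>\<^sup>2 * f (x + \<rho> *\<^sub>R w)))"
    by simp
  have "integral A f = integral (sphmap x ` (B - N)) f"
  proof (rule integral_spike_set)
    \<comment> \<open>Points of the shell missed by the open parameter range lie in a plane, hence
      form a null set.\<close>
    have "A - sphmap x ` (B - N) \<subseteq> {y. y$2 = x$2}"
    proof (clarify, rule ccontr)
      fix y assume y: "y \<in> A" "y \<notin> sphmap x ` (B - N)" "y$2 \<noteq> x$2"
      then obtain \<theta> \<phi> where *: "0 < \<theta>" "\<theta> < pi" "0 < \<phi>" "\<phi> < 2*pi" "y - x = norm (y - x) *\<^sub>R sph \<theta> \<phi>"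
        using spherical_coordinates_exist[of "y - x"] by auto
      have "y = sphmap x (vector [norm (y - x), \<theta>, \<phi>])"
        using * by (simp add: sphmap_def algebra_simps)
      moreover have "vector [norm (y - x), \<theta>, \<phi>] \<in> B - N"
        unfolding SB using * y by (auto simp: A_def)
      ultimately show False
        using y by blast
    qed
    then show "negligible {y \<in> A - sphmap x ` (B - N). f y \<noteq> 0}"
      by (intro negligible_subset[OF negligible_coordinate_plane[of 2 "x$2"]]) auto
    have "sphmap x ` (B - N) \<subseteq> A"
    proof clarify
      fix z assume "z \<in> B" "z \<notin> N"
      then have "a \<le> z$1 \<and> z$1 \<le> b \<and> 0 < z$1"
        using SB[of z] by blast
      then show "sphmap x z \<in> A"
        by (simp add: A_def sphmap_def)
    qed
    then show "negligible {y \<in> sphmap x ` (B - N) - A. f y \<noteq> 0}"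
      by (simp add: Diff_eq_empty_iff[THEN iffD2])
  qed
  with 1 show ?thesis
    by (simp add: A_def)
qed

section \<open>The radial identity\<close>

lemma pdiff_C1_deriv: "C1_deriv f f' \<Longrightarrow> pdiff f i y = f' y (axis i 1)"
  unfolding pdiff_def using frechet_derivative_at[OF C1_derivD] by metis

lemma divg_C1_deriv: "C1_deriv F F' \<Longrightarrow> divg F y = tr (F' y)"
  unfolding divg_def tr_def by (simp add: pdiff_C1_deriv[OF C1_deriv_component])

lemma inner_eq_linear:
  fixes A :: "real^3 \<Rightarrow> real"
  assumes "linear A"
  shows "w \<bullet> (\<chi> i. A (axis i 1)) = A w"
  by (subst linear_expand_axis[OF assms]) (simp add: inner_vec_def)

text \<open>A rank-one map \<open>h \<mapsto> l(h) v\<close> has trace \<open>l(v)\<close>. With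
  \<open>d = y - x\<close>, \<open>s = d \<bullet> v\<close> and \<open>A\<close> the derivative of
  \<open>v\<close>, the map is the derivative of \<open>((y - x) \<bullet> v) v\<close>.\<close>

lemma tr_rank_one_perturbation:
  assumes "linear A"
  shows "tr (\<lambda>h. s *\<^sub>R A h + (d \<bullet> A h + h \<bullet> v) *\<^sub>R v) = s * tr A + d \<bullet> A v + v \<bullet> v"
proof -
  have "tr (\<lambda>h. s *\<^sub>R A h + (d \<bullet> A h + h \<bullet> v) *\<^sub>R v) =
      s * tr A + (\<Sum>i\<in>UNIV. v$i * (d \<bullet> A (axis i 1))) + v \<bullet> v"
    by (simp add: tr_def sum.distrib sum_distrib_left inner_axis' inner_vec_def[of v v] algebra_simps)
  also have "(\<Sum>i\<in>UNIV. v$i * (d \<bullet> A (axis i 1))) = d \<bullet> A v"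
    by (simp add: linear_expand_axis[OF assms, of v] inner_sum_right)
  finally show ?thesis .
qed

text \<open>The scaled flux has zero derivative on the whole line and vanishes at
  \<open>\<rho> = 0\<close> because of the factor \<open>\<rho>\<^sup>2\<close>.\<close>

lemma flux_divergence_free:
  assumes F: "C1_deriv F F'" and "\<And>y. tr (F' y) = 0" and "\<rho> \<noteq> 0"
  shows "sint (\<lambda>w. w \<bullet> F (x + \<rho> *\<^sub>R w)) = 0"
proof -
  have "((\<lambda>\<rho>. \<rho>\<^sup>2 * sint (\<lambda>w. w \<bullet> F (x + \<rho> *\<^sub>R w))) has_real_derivative 0) (at \<rho>)" for \<rho>
    using flux_has_derivative[OF F, of x \<rho>] assms(2) by (simp add: sint_const)
  then have "\<rho>\<^sup>2 * sint (\<lambda>w. w \<bullet> F (x + \<rho> *\<^sub>R w)) = 0\<^sup>2 * sint (\<lambda>w. w \<bullet> F (x + 0 *\<^sub>R w))"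
    using DERIV_isconst_all by blast
  with assms(3) show ?thesis
    by simp
qed

text \<open>Differentiating the flux in the centre of the sphere replaces the symmetry of second
  derivatives, which would give \<open>div (\<partial>\<^sub>c u) = 0\<close>.\<close>
lemma flux_directional_derivative:
  assumes u: "C1_deriv u u'" and "\<And>y. tr (u' y) = 0" and "\<rho> \<noteq> 0"
  shows "sint (\<lambda>w. w \<bullet> u' (x + \<rho> *\<^sub>R w) c) = 0"
proof -
  let ?f = "\<lambda>t w. w \<bullet> u ((x + \<rho> *\<^sub>R w) + t *\<^sub>R c)"
  have "((\<lambda>t. sint (?f t)) has_real_derivative sint (\<lambda>w. w \<bullet> u' ((x + \<rho> *\<^sub>R w) + 0 *\<^sub>R c) c)) (at 0)"
  proof (rule sint_has_derivative_param)
    show "((\<lambda>t. ?f t w) has_real_derivative w \<bullet> u' ((x + \<rho> *\<^sub>R w) + t *\<^sub>R c) c) (at t)" for t w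
      using has_real_derivative_inner[OF has_vector_derivative_const C1_deriv_along_line[OF u]] by simp
    show "continuous_on UNIV (?f t)" for t
      by (intro continuous_intros C1_deriv_continuous[OF u])
    show "continuous_on UNIV (\<lambda>(t, w). w \<bullet> u' ((x + \<rho> *\<^sub>R w) + t *\<^sub>R c) c)"
      unfolding case_prod_unfold by (intro continuous_intros C1_deriv_continuous_deriv[OF u])
  qed
  moreover have "sint (?f t) = 0" for t
    using flux_divergence_free[OF assms, of "x + t *\<^sub>R c"] by (simp add: ac_simps)
  then have "((\<lambda>t. sint (?f t)) has_real_derivative 0) (at 0)"
    by simp
  ultimately have "sint (\<lambda>w. w \<bullet> u' ((x + \<rho> *\<^sub>R w) + 0 *\<^sub>R c) c) = 0"
    by (rule DERIV_unique)
  then show ?thesis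
    by simp
qed

text \<open>With \<open>P\<close>, \<open>Q\<close>, \<open>E\<close>, \<open>R\<close> as in the
  proof, the flux of \<open>\<nabla>p + (u\<cdot>\<nabla>)u\<close> gives \<open>P' = - E\<close>,
  and that of \<open>((y-x)\<cdot>v) v\<close> gives \<open>\<rho> Q' = R + \<rho> E - 3 Q\<close>.
  In the sum the term \<open>E\<close>, which contains derivatives of \<open>u\<close>,
  cancels.\<close>

lemma radial_identity:
  fixes u :: "real^3 \<Rightarrow> real^3" and p :: "real^3 \<Rightarrow> real" and x :: "real^3"
  assumes "C2 u" "\<forall>y. divg u y = 0" "C2 p" and eq: "\<forall>y. - lap p y = divg (conv u) y"
  defines "K \<equiv> \<lambda>\<rho>. sint (\<lambda>w. p (x + \<rho> *\<^sub>R w)) + sint (\<lambda>w. (w \<bullet> (u (x + \<rho> *\<^sub>R w) - u x))\<^sup>2)"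
  shows "continuous_on UNIV K"
    and "\<rho> > 0 \<Longrightarrow> (K has_real_derivative - sint (\<lambda>w. 3 * (w \<bullet> (u (x + \<rho> *\<^sub>R w) - u x))\<^sup>2
        - (norm (u (x + \<rho> *\<^sub>R w) - u x))\<^sup>2) / \<rho>) (at \<rho>)"
proof -
  obtain u' u'' where u: "C1_deriv u u'" and u2: "\<And>h. C1_deriv (\<lambda>y. u' y h) (\<lambda>y k. u'' y k h)"
    using C2_imp_C1_deriv[OF assms(1)] by blast
  obtain p' p'' where p: "C1_deriv p p'" and p2: "\<And>h. C1_deriv (\<lambda>y. p' y h) (\<lambda>y k. p'' y k h)"
    using C2_imp_C1_deriv[OF assms(3)] by blast
  \<comment> \<open>Freezing \<open>u x\<close> as a constant gives \<open>?v\<close> the same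
    derivative \<open>u'\<close> as \<open>u\<close>.\<close>
  define c where "c = u x"
  let ?v = "\<lambda>y. u y - c"
  have v: "C1_deriv ?v u'"
    by (rule C1_deriv_diff_const[OF u])
  note cont = continuous_intros C1_deriv_continuous[OF u] C1_deriv_continuous_deriv[OF u]
    C1_deriv_continuous[OF p] C1_deriv_continuous_deriv[OF p]
  have tru: "tr (u' y) = 0" for y
    using assms(2) divg_C1_deriv[OF u] by simp
  have conv: "conv u y = u' y (u y)" for y
    by (subst linear_expand_axis[OF C1_deriv_linear[OF u]])
      (simp add: conv_def vec_eq_iff pdiff_C1_deriv[OF C1_deriv_component[OF u]])
  \<comment> \<open>Only existence is recorded: the trace of \<open>C'\<close> is the divergence of
    \<open>conv u\<close>, which the pressure equation determines.\<close>
  have "\<exists>C'. C1_deriv (conv u) C'"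
    unfolding conv_def[abs_def] pdiff_C1_deriv[OF C1_deriv_component[OF u]] real_scaleR_def[symmetric]
    by (rule exI, rule C1_deriv_vec_lambda, rule C1_deriv_sum, rule C1_deriv_scaleR)
      (rule C1_deriv_component u u2)+
  then obtain C' where C: "C1_deriv (conv u) C'"
    by blast
  let ?G = "\<lambda>y. \<chi> i. p' y (axis i 1)"
  have G: "C1_deriv ?G (\<lambda>y k. \<chi> i. p'' y k (axis i 1))"
    by (rule C1_deriv_vec_lambda[OF p2])
  have "lap p y = tr (\<lambda>k. \<chi> i. p'' y k (axis i 1))" for y
    by (simp add: lap_def tr_def pdiff_C1_deriv[OF p] pdiff_C1_deriv[OF p2])
  then have tr0: "tr (\<lambda>k. (\<chi> i. p'' y k (axis i 1)) + C' y k) = 0" for y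
    using eq[rule_format, of y] divg_C1_deriv[OF C] by (simp add: tr_def sum.distrib)
  define P where "P \<rho> = sint (\<lambda>w. p (x + \<rho> *\<^sub>R w))" for \<rho>
  define Q where "Q \<rho> = sint (\<lambda>w. (w \<bullet> ?v (x + \<rho> *\<^sub>R w))\<^sup>2)" for \<rho>
  define Q' where "Q' \<rho> = sint (\<lambda>w. 2 * ((w \<bullet> ?v (x + \<rho> *\<^sub>R w)) * (w \<bullet> u' (x + \<rho> *\<^sub>R w) w)))" for \<rho>
  define E where "E \<rho> = sint (\<lambda>w. w \<bullet> u' (x + \<rho> *\<^sub>R w) (?v (x + \<rho> *\<^sub>R w)))" for \<rho>
  define R where "R \<rho> = sint (\<lambda>w. (norm (?v (x + \<rho> *\<^sub>R w)))\<^sup>2)" for \<rho>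
  have dP: "(P has_real_derivative sint (\<lambda>w. p' (x + \<rho> *\<^sub>R w) w)) (at \<rho>)" for \<rho>
    unfolding P_def
  proof (rule sint_has_derivative_param)
    show "((\<lambda>t. p (x + t *\<^sub>R w)) has_real_derivative p' (x + t *\<^sub>R w) w) (at t)" for t w
      using C1_deriv_along_line[OF p] by (simp add: has_real_derivative_iff_has_vector_derivative)
    show "continuous_on UNIV (\<lambda>w. p (x + t *\<^sub>R w))" for t
      by (intro cont)
    show "continuous_on UNIV (\<lambda>(t, w). p' (x + t *\<^sub>R w) w)"
      unfolding case_prod_unfold by (intro cont)
  qed
  have dQ: "(Q has_real_derivative Q' \<rho>) (at \<rho>)" for \<rho>
    unfolding Q_def Q'_def
  proof (rule sint_has_derivative_param)
    show "((\<lambda>t. (w \<bullet> ?v (x + t *\<^sub>R w))\<^sup>2) has_real_derivative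
        2 * ((w \<bullet> ?v (x + t *\<^sub>R w)) * (w \<bullet> u' (x + t *\<^sub>R w) w))) (at t)" for t w
    proof -
      have "((\<lambda>t. w \<bullet> ?v (x + t *\<^sub>R w)) has_real_derivative w \<bullet> u' (x + t *\<^sub>R w) w) (at t)"
        using has_real_derivative_inner[OF has_vector_derivative_const C1_deriv_along_line[OF v]] by simp
      from DERIV_mult[OF this this] show ?thesis
        unfolding power2_eq_square by (rule DERIV_cong) simp
    qed
    show "continuous_on UNIV (\<lambda>w. (w \<bullet> ?v (x + t *\<^sub>R w))\<^sup>2)" for t
      by (intro cont)
    show "continuous_on UNIV (\<lambda>(t, w). 2 * ((w \<bullet> ?v (x + t *\<^sub>R w)) * (w \<bullet> u' (x + t *\<^sub>R w) w)))"
      unfolding case_prod_unfold by (intro cont)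
  qed
  have PE: "sint (\<lambda>w. p' (x + \<rho> *\<^sub>R w) w) = - E \<rho>" if "\<rho> \<noteq> 0" for \<rho>
  proof -
    have "0 = sint (\<lambda>w. w \<bullet> (?G (x + \<rho> *\<^sub>R w) + conv u (x + \<rho> *\<^sub>R w)))"
      using flux_divergence_free[OF C1_deriv_add[OF G C] tr0 that] by simp
    \<comment> \<open>The convective term \<open>u' y (u y)\<close> is split by
      \<open>u = v + c\<close>; the part along the constant \<open>c\<close> has zero flux by
      \<open>flux_directional_derivative\<close>.\<close>
    also have "\<dots> = sint (\<lambda>w. (p' (x + \<rho> *\<^sub>R w) w + w \<bullet> u' (x + \<rho> *\<^sub>R w) (?v (x + \<rho> *\<^sub>R w))) + w \<bullet> u' (x + \<rho> *\<^sub>R w) c)"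
      by (simp add: inner_add_right inner_eq_linear[OF C1_deriv_linear[OF p]] conv
          linear_diff[OF C1_deriv_linear[OF u]] inner_diff_right)
    also have "\<dots> = (sint (\<lambda>w. p' (x + \<rho> *\<^sub>R w) w) + E \<rho>) + sint (\<lambda>w. w \<bullet> u' (x + \<rho> *\<^sub>R w) c)"
      unfolding E_def by (subst sint_add, intro cont, intro cont, subst sint_add, intro cont, intro cont, rule refl)
    finally show ?thesis
      using flux_directional_derivative[OF u tru that] by simp
  qed
  let ?H = "\<lambda>y. ((y - x) \<bullet> ?v y) *\<^sub>R ?v y"
  let ?H' = "\<lambda>y h. ((y - x) \<bullet> ?v y) *\<^sub>R u' y h + ((y - x) \<bullet> u' y h + h \<bullet> ?v y) *\<^sub>R ?v y"
  have H: "C1_deriv ?H ?H'"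
    by (rule C1_deriv_scaleR[OF C1_deriv_inner[OF C1_deriv_diff_const[OF C1_deriv_ident] v] v])
  have trH: "tr (?H' y) = (norm (?v y))\<^sup>2 + (y - x) \<bullet> u' y (?v y)" for y
    by (simp add: tr_rank_one_perturbation[OF C1_deriv_linear[OF u]] tru dot_square_norm)
  have QR: "\<rho> * Q' \<rho> = R \<rho> + \<rho> * E \<rho> - 3 * Q \<rho>" if "\<rho> \<noteq> 0" for \<rho>
  proof -
    \<comment> \<open>On the sphere \<open>y - x = \<rho> w\<close>, so the flux density of
      \<open>?H\<close> is \<open>\<rho>\<close> times the square of the radial component of
      \<open>v\<close>.\<close>
    have "\<rho>\<^sup>2 * sint (\<lambda>w. w \<bullet> ?H (x + \<rho> *\<^sub>R w)) = \<rho> ^ 3 * Q \<rho>" for \<rho>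
    proof -
      have "sint (\<lambda>w. w \<bullet> ?H (x + \<rho> *\<^sub>R w)) = sint (\<lambda>w. \<rho> * (w \<bullet> ?v (x + \<rho> *\<^sub>R w))\<^sup>2)"
        by (simp add: power2_eq_square mult.assoc)
      then show ?thesis
        by (simp add: Q_def sint_cmult power2_eq_square power3_eq_cube)
    qed
    moreover have "sint (\<lambda>w. tr (?H' (x + \<rho> *\<^sub>R w))) = R \<rho> + \<rho> * E \<rho>"
    proof -
      have "sint (\<lambda>w. tr (?H' (x + \<rho> *\<^sub>R w))) = sint (\<lambda>w. (norm (?v (x + \<rho> *\<^sub>R w)))\<^sup>2 + \<rho> * (w \<bullet> u' (x + \<rho> *\<^sub>R w) (?v (x + \<rho> *\<^sub>R w))))"
        unfolding trH by simp
      also have "\<dots> = R \<rho> + \<rho> * E \<rho>"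
        unfolding R_def E_def by (subst sint_add, intro cont, intro cont, subst sint_cmult, rule refl)
      finally show ?thesis .
    qed
    ultimately have "((\<lambda>\<rho>. \<rho> ^ 3 * Q \<rho>) has_real_derivative \<rho>\<^sup>2 * (R \<rho> + \<rho> * E \<rho>)) (at \<rho>)"
      using flux_has_derivative[OF H, of x \<rho>] by simp
    \<comment> \<open>The product rule gives a second expression for the same derivative; comparing
      the two and cancelling \<open>\<rho>\<^sup>2\<close> isolates \<open>Q'\<close>.\<close>
    moreover have "((\<lambda>\<rho>. \<rho> ^ 3 * Q \<rho>) has_real_derivative 3 * \<rho>\<^sup>2 * Q \<rho> + \<rho> ^ 3 * Q' \<rho>) (at \<rho>)"
      by (rule DERIV_cong[OF DERIV_mult[OF DERIV_pow dQ]]) simp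
    ultimately have "\<rho>\<^sup>2 * (R \<rho> + \<rho> * E \<rho>) = 3 * \<rho>\<^sup>2 * Q \<rho> + \<rho> ^ 3 * Q' \<rho>"
      by (rule DERIV_unique)
    then have "\<rho>\<^sup>2 * (\<rho> * Q' \<rho>) = \<rho>\<^sup>2 * (R \<rho> + \<rho> * E \<rho> - 3 * Q \<rho>)"
      by (simp add: algebra_simps power2_eq_square power3_eq_cube)
    with that show ?thesis
      by simp
  qed
  have K: "K = (\<lambda>\<rho>. P \<rho> + Q \<rho>)"
    by (simp add: K_def P_def Q_def c_def)
  have dK: "(K has_real_derivative sint (\<lambda>w. p' (x + \<rho> *\<^sub>R w) w) + Q' \<rho>) (at \<rho>)" for \<rho>
    unfolding K by (rule DERIV_add[OF dP dQ])
  then show "continuous_on UNIV K"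
    using DERIV_isCont by (blast intro: continuous_at_imp_continuous_on)
  assume "\<rho> > 0"
  have "sint (\<lambda>w. 3 * (w \<bullet> ?v (x + \<rho> *\<^sub>R w))\<^sup>2 - (norm (?v (x + \<rho> *\<^sub>R w)))\<^sup>2) = 3 * Q \<rho> - R \<rho>"
    unfolding Q_def R_def by (subst sint_diff, intro cont, intro cont, subst sint_cmult, rule refl)
  moreover have "sint (\<lambda>w. p' (x + \<rho> *\<^sub>R w) w) + Q' \<rho> = - (3 * Q \<rho> - R \<rho>) / \<rho>"
    using QR[of \<rho>] PE[of \<rho>] \<open>\<rho> > 0\<close> by (simp add: field_simps)
  ultimately show "(K has_real_derivative - sint (\<lambda>w. 3 * (w \<bullet> (u (x + \<rho> *\<^sub>R w) - u x))\<^sup>2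
        - (norm (u (x + \<rho> *\<^sub>R w) - u x))\<^sup>2) / \<rho>) (at \<rho>)"
    using dK[of \<rho>] unfolding c_def by simp
qed

section \<open>The representation formula\<close>

lemma wgt_eq_min_max: "wgt t = min 1 (max 0 (2 - t))"
  by (simp add: wgt_def)

lemma continuous_on_wgt [continuous_intros]:
  "continuous_on S f \<Longrightarrow> continuous_on S (\<lambda>s. wgt (f s))"
  unfolding wgt_eq_min_max by (intro continuous_intros)

text \<open>The weight is constant up to \<open>r\<close> and then has slope \<open>- 1 / r\<close>,
  which produces the mean of \<open>K\<close> over \<open>{r..2*r}\<close>. At the endpoints it
  equals 1 and 0, so only \<open>K 0\<close> survives.\<close>

lemma weighted_ftc:
  assumes "r > 0" and K: "continuous_on UNIV K"
    and K': "\<And>\<rho>. \<rho> > 0 \<Longrightarrow> (K has_real_derivative - k \<rho>) (at \<rho>)"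
  shows "((\<lambda>\<rho>. wgt (\<rho> / r) * k \<rho>) has_integral K 0 - integral {r..2*r} K / r) {0..2*r}"
proof -
  have J: "((\<lambda>\<rho>. - (wgt (\<rho> / r) * k \<rho>) - (if \<rho> \<in> {r..2*r} then K \<rho> / r else 0)) has_integral
      wgt (2*r/r) * K (2*r) - wgt (0/r) * K 0) {0..2*r}"
  \<comment> \<open>The kink of the weight at \<open>r\<close> is the exceptional point; at
    \<open>\<rho> = 0\<close> continuity of \<open>K\<close> is enough.\<close>
  proof (rule fundamental_theorem_of_calculus_interior_strong[where S="{r}"])
    show "continuous_on {0..2*r} (\<lambda>\<rho>. wgt (\<rho> / r) * K \<rho>)"
      using assms(1) by (intro continuous_intros continuous_on_subset[OF K]) auto
    fix \<rho> assume \<rho>: "\<rho> \<in> {0<..<2*r} - {r}"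
    show "((\<lambda>\<rho>. wgt (\<rho> / r) * K \<rho>) has_vector_derivative
        - (wgt (\<rho> / r) * k \<rho>) - (if \<rho> \<in> {r..2*r} then K \<rho> / r else 0)) (at \<rho>)"
      unfolding has_real_derivative_iff_has_vector_derivative[symmetric]
    proof (cases "\<rho> < r")
      case True
      have "((\<lambda>\<rho>. K \<rho>) has_real_derivative - k \<rho>) (at \<rho>)"
        using K' \<rho> by auto
      then have "((\<lambda>\<rho>. wgt (\<rho> / r) * K \<rho>) has_real_derivative - k \<rho>) (at \<rho>)"
        by (rule has_field_derivative_transform_within_open[where S="{..<r}"])
          (use True assms(1) in \<open>auto simp: wgt_def\<close>)
      then show "((\<lambda>\<rho>. wgt (\<rho> / r) * K \<rho>) has_real_derivative
          - (wgt (\<rho> / r) * k \<rho>) - (if \<rho> \<in> {r..2*r} then K \<rho> / r else 0)) (at \<rho>)"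
        using True assms(1) by (simp add: wgt_def)
    next
      case False
      then have r: "r < \<rho>" "\<rho> < 2*r"
        using \<rho> by auto
      have "((\<lambda>\<rho>. (2 - \<rho> / r) * K \<rho>) has_real_derivative (2 - \<rho> / r) * (- k \<rho>) - K \<rho> / r) (at \<rho>)"
        using K'[of \<rho>] r assms(1) by (auto intro!: derivative_eq_intros)
      then have "((\<lambda>\<rho>. wgt (\<rho> / r) * K \<rho>) has_real_derivative (2 - \<rho> / r) * (- k \<rho>) - K \<rho> / r) (at \<rho>)"
        by (rule has_field_derivative_transform_within_open[where S="{r<..<2*r}"])
          (use r assms(1) in \<open>auto simp: wgt_def field_simps\<close>)
      then show "((\<lambda>\<rho>. wgt (\<rho> / r) * K \<rho>) has_real_derivative
          - (wgt (\<rho> / r) * k \<rho>) - (if \<rho> \<in> {r..2*r} then K \<rho> / r else 0)) (at \<rho>)"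
        using r assms(1) by (simp add: wgt_def field_simps)
    qed
  qed (use assms(1) in auto)
  have I: "((\<lambda>\<rho>. if \<rho> \<in> {r..2*r} then K \<rho> / r else 0) has_integral integral {r..2*r} K / r) {0..2*r}"
  proof -
    have "(K has_integral integral {r..2*r} K) {r..2*r}"
      by (intro integrable_integral integrable_continuous_interval continuous_on_subset[OF K]) auto
    then have "((\<lambda>\<rho>. K \<rho> / r) has_integral integral {r..2*r} K / r) {r..2*r}"
      by (rule has_integral_divide)
    then show ?thesis
      by (subst has_integral_restrict) (use assms(1) in auto)
  qed
  have "((\<lambda>\<rho>. wgt (\<rho> / r) * k \<rho>) has_integral
      - (wgt (2*r/r) * K (2*r) - wgt (0/r) * K 0 + integral {r..2*r} K / r)) {0..2*r}"
    using has_integral_neg[OF has_integral_add[OF J I]] by simp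
  then show ?thesis
    using assms(1) by (simp add: wgt_def)
qed

lemma sph_avg_eq_sint:
  assumes "continuous_on UNIV p"
  shows "sph_avg p x \<rho> = sint (\<lambda>w. p (x + \<rho> *\<^sub>R w)) / (4 * pi)"
  unfolding sph_avg_def
  by (subst sint_iterated) (auto intro!: continuous_on_compose2[OF assms] continuous_intros)

text \<open>The contraction of \<open>sigma\<close> with \<open>v\<close> twice, in the shape of the
  second integrand of \<open>piterm\<close>: \<open>a\<close> stands for the weight and
  \<open>b\<close> for the cubed distance.\<close>

lemma sum_sigma_quadratic:
  "(\<Sum>i\<in>UNIV. \<Sum>j\<in>UNIV. a * sigma i j w / b * v$i * v$j) = a * (3 * (w \<bullet> v)\<^sup>2 - (norm v)\<^sup>2) / b"
  unfolding power2_norm_eq_inner inner_3 sum_3 sigma_def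
  by (simp add: divide_inverse power2_eq_square algebra_simps)

text \<open>The definition of the derivative with error tolerance 1 gives the constant
  \<open>1 + onorm f'\<close>. Applied to \<open>u\<close>, it controls the singular kernel near
  \<open>x\<close>.\<close>

lemma locally_lipschitz_at:
  assumes "(f has_derivative f') (at x)"
  obtains B d where "0 < d" "0 \<le> B" "\<And>y. norm (y - x) < d \<Longrightarrow> norm (f y - f x) \<le> B * norm (y - x)"
proof -
  have bl: "bounded_linear f'"
    using assms has_derivative_bounded_linear by blast
  obtain d where d: "d > 0" "\<And>y. norm (y - x) < d \<Longrightarrow> norm (f y - f x - f' (y - x)) \<le> 1 * norm (y - x)"
    using assms unfolding has_derivative_at_alt by (meson zero_less_one)
  show ?thesis
  proof (rule that[of d "1 + onorm f'"])
    fix y assume "norm (y - x) < d"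
    then have "norm (f y - f x - f' (y - x)) \<le> norm (y - x)"
      using d by simp
    moreover have "norm (f' (y - x)) \<le> onorm f' * norm (y - x)"
      by (rule onorm[OF bl])
    ultimately show "norm (f y - f x) \<le> (1 + onorm f') * norm (y - x)"
      using norm_triangle_sub[of "f y - f x" "f' (y - x)"] by (simp add: algebra_simps)
  qed (use d onorm_pos_le[OF bl] in auto)
qed

text \<open>At \<open>\<rho> = 0\<close> the quotient is \<open>0\<close> by the convention \<open>a / 0 = 0\<close>, which is also its limit.\<close>
lemma continuous_on_singular_kernel:
  fixes u :: "real^3 \<Rightarrow> real^3"
  assumes uc: "continuous_on UNIV u" and du: "(u has_derivative u') (at x)" and r: "r > 0"
  shows "continuous_on (cbox (0, 0, 0) (b, pi, 2*pi)) (\<lambda>(\<rho>, \<theta>, \<phi>). sin \<theta> *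
    (wgt (\<rho> / r) * (3 * (sph \<theta> \<phi> \<bullet> (u (x + \<rho> *\<^sub>R sph \<theta> \<phi>) - u x))\<^sup>2 - (norm (u (x + \<rho> *\<^sub>R sph \<theta> \<phi>) - u x))\<^sup>2) / \<rho>))"
    (is "continuous_on ?B ?m")
  unfolding continuous_on_eq_continuous_within
proof
  fix z0 assume z0: "z0 \<in> ?B"
  show "continuous (at z0 within ?B) ?m"
  proof (cases "fst z0 = 0")
    case False
    then have pos: "z0 \<in> {z. fst z > 0}"
      using z0 by (auto simp: cbox_triple)
    have "continuous_on {z :: real \<times> real \<times> real. fst z > 0} ?m"
      unfolding case_prod_unfold
      by (intro continuous_intros continuous_on_compose2[OF uc]) (use r in auto)
    moreover have "open {z :: real \<times> real \<times> real. fst z > 0}"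
      by (intro open_Collect_less continuous_intros)
    ultimately have "isCont ?m z0"
      using pos continuous_on_eq_continuous_at by blast
    then show ?thesis
      by (rule continuous_at_imp_continuous_at_within)
  next
    case True
    obtain B d where d: "0 < d" "0 \<le> B" and lip: "\<And>y. norm (y - x) < d \<Longrightarrow> norm (u y - u x) \<le> B * norm (y - x)"
      using locally_lipschitz_at[OF du] by blast
    \<comment> \<open>Since \<open>norm v \<le> B * \<rho>\<close>, the quadratic form is at most
      \<open>(3 + 1) * (B * \<rho>)\<^sup>2\<close>, and division by \<open>\<rho>\<close> leaves a
      bound tending to 0.\<close>
    have bound: "norm (?m z) \<le> 4 * B\<^sup>2 * fst z" if "z \<in> ?B" "fst z < d" for z
    proof -
      obtain \<rho> \<theta> \<phi> where z: "z = (\<rho>, \<theta>, \<phi>)"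
        by (metis prod_cases3)
      define v where "v = u (x + \<rho> *\<^sub>R sph \<theta> \<phi>) - u x"
      have \<rho>: "0 \<le> \<rho>" "\<rho> < d"
        using that by (auto simp: z cbox_triple)
      have v: "norm v \<le> B * \<rho>"
        unfolding v_def using lip[of "x + \<rho> *\<^sub>R sph \<theta> \<phi>"] \<rho> by simp
      have "\<bar>sph \<theta> \<phi> \<bullet> v\<bar> \<le> norm v"
        using Cauchy_Schwarz_ineq2[of "sph \<theta> \<phi>" v] by simp
      then have "(sph \<theta> \<phi> \<bullet> v)\<^sup>2 \<le> (norm v)\<^sup>2"
        by (metis abs_norm_cancel abs_le_square_iff)
      then have "\<bar>3 * (sph \<theta> \<phi> \<bullet> v)\<^sup>2 - (norm v)\<^sup>2\<bar> \<le> 4 * (norm v)\<^sup>2"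
        using zero_le_power2[of "sph \<theta> \<phi> \<bullet> v"] by linarith
      also have "\<dots> \<le> 4 * (B * \<rho>)\<^sup>2"
        using v by (simp add: power_mono)
      finally have S: "\<bar>3 * (sph \<theta> \<phi> \<bullet> v)\<^sup>2 - (norm v)\<^sup>2\<bar> \<le> 4 * B\<^sup>2 * \<rho> * \<rho>"
        by (simp add: power_mult_distrib power2_eq_square mult_ac)
      have sw: "\<bar>sin \<theta> * wgt (\<rho> / r)\<bar> \<le> 1"
        using mult_mono[of "\<bar>sin \<theta>\<bar>" 1 "\<bar>wgt (\<rho> / r)\<bar>" 1] by (simp add: abs_mult wgt_eq_min_max)
      have "norm (?m z) = \<bar>sin \<theta> * wgt (\<rho> / r)\<bar> * \<bar>3 * (sph \<theta> \<phi> \<bullet> v)\<^sup>2 - (norm v)\<^sup>2\<bar> / \<rho>"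
        using \<rho> by (simp add: z v_def abs_mult)
      also have "\<dots> \<le> 1 * (4 * B\<^sup>2 * \<rho> * \<rho>) / \<rho>"
        by (intro divide_right_mono mult_mono sw S) (use \<rho> in auto)
      also have "\<dots> \<le> 4 * B\<^sup>2 * fst z"
        using \<rho> by (simp add: z)
      finally show ?thesis .
    qed
    have "(?m \<longlongrightarrow> 0) (at z0 within ?B)"
    proof (rule Lim_null_comparison)
      have "\<forall>\<^sub>F z in at z0 within ?B. z \<in> ?B"
        by (simp add: eventually_at_filter)
      moreover have "\<forall>\<^sub>F z in at z0 within ?B. fst z < d"
      proof (rule order_tendstoD)
        show "(fst \<longlongrightarrow> fst z0) (at z0 within ?B)"
          by (intro tendsto_intros)
      qed (use True d in simp)
      ultimately show "\<forall>\<^sub>F z in at z0 within ?B. norm (?m z) \<le> 4 * B\<^sup>2 * fst z"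
        by eventually_elim (rule bound)
      have "((\<lambda>z. 4 * B\<^sup>2 * fst z) \<longlongrightarrow> 4 * B\<^sup>2 * fst z0) (at z0 within ?B)"
        by (intro tendsto_intros)
      then show "((\<lambda>z. 4 * B\<^sup>2 * fst z) \<longlongrightarrow> 0) (at z0 within ?B)"
        using True by simp
    qed
    moreover have "?m z0 = 0"
      using True by (simp add: case_prod_unfold)
    ultimately show ?thesis
      unfolding continuous_within by metis
  qed
qed

theorem theorem1:
  fixes u :: "real^3 \<Rightarrow> real^3" and p :: "real^3 \<Rightarrow> real"
  assumes u_C2: "C2 u"
    and u_L2: "(\<lambda>x. norm (u x) ^ 2) integrable_on UNIV"
    and div_free: "\<forall>x. divg u x = 0"
    and p_C2: "C2 p"
    and eq: "\<forall>x. - lap p x = divg (conv u) x"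
  shows "\<forall>x. \<forall>r>0. p x = beta p x r + piterm u x r"
proof (intro allI impI)
  fix x :: "real^3" and r :: real assume r: "r > 0"
  obtain u' u'' where u: "C1_deriv u u'" and "\<And>h. C1_deriv (\<lambda>y. u' y h) (\<lambda>y k. u'' y k h)"
    using C2_imp_C1_deriv[OF u_C2] by blast
  obtain p' p'' where p: "C1_deriv p p'" and "\<And>h. C1_deriv (\<lambda>y. p' y h) (\<lambda>y k. p'' y k h)"
    using C2_imp_C1_deriv[OF p_C2] by blast
  note cont = continuous_intros C1_deriv_continuous[OF u] C1_deriv_continuous[OF p]
  define P where "P \<rho> = sint (\<lambda>w. p (x + \<rho> *\<^sub>R w))" for \<rho>
  define Q where "Q \<rho> = sint (\<lambda>w. (w \<bullet> (u (x + \<rho> *\<^sub>R w) - u x))\<^sup>2)" for \<rho>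
  define k where "k \<rho> = sint (\<lambda>w. 3 * (w \<bullet> (u (x + \<rho> *\<^sub>R w) - u x))\<^sup>2 - (norm (u (x + \<rho> *\<^sub>R w) - u x))\<^sup>2) / \<rho>" for \<rho>
  have PQ: "continuous_on UNIV (\<lambda>\<rho>. P \<rho> + Q \<rho>)"
    "\<And>\<rho>. \<rho> > 0 \<Longrightarrow> ((\<lambda>\<rho>. P \<rho> + Q \<rho>) has_real_derivative - k \<rho>) (at \<rho>)"
    using radial_identity[OF u_C2 div_free p_C2 eq, where x=x] unfolding P_def Q_def k_def by auto
  have cP: "continuous_on UNIV P" and cQ: "continuous_on UNIV Q"
    unfolding P_def Q_def by (rule sint_continuous_param; unfold case_prod_unfold; intro cont)+
  have W: "integral {0..2*r} (\<lambda>\<rho>. wgt (\<rho> / r) * k \<rho>) = 4 * pi * p x - (integral {r..2*r} P + integral {r..2*r} Q) / r"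
  proof -
    \<comment> \<open>At radius 0 the integrand of \<open>P\<close> is the constant
      \<open>p x\<close> and that of \<open>Q\<close> vanishes.\<close>
    have "P 0 + Q 0 = 4 * pi * p x"
      by (simp add: P_def Q_def sint_const)
    moreover have "integral {r..2*r} (\<lambda>\<rho>. P \<rho> + Q \<rho>) = integral {r..2*r} P + integral {r..2*r} Q"
      by (intro integral_add integrable_continuous_interval continuous_on_subset[OF cP] continuous_on_subset[OF cQ]) auto
    ultimately show ?thesis
      using weighted_ftc[OF r PQ] by (simp add: integral_unique)
  qed
  have beta: "beta p x r = integral {r..2*r} P / (4 * pi * r)"
    by (simp add: beta_def P_def[abs_def] mult.commute sph_avg_eq_sint[OF C1_deriv_continuous[OF p continuous_on_id]])
  have shell: "integral {y. r \<le> norm (y - x) \<and> norm (y - x) \<le> 2 * r}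
        (\<lambda>y. (1 / norm (y - x) ^ 2) * (((y - x) /\<^sub>R norm (y - x)) \<bullet> (u y - u x)) ^ 2) = integral {r..2*r} Q"
    (is "integral _ ?f = _")
  proof -
    \<comment> \<open>The Jacobian factor cancels the inverse square of the distance.\<close>
    have f: "\<rho>\<^sup>2 * ?f (x + \<rho> *\<^sub>R w) = (w \<bullet> (u (x + \<rho> *\<^sub>R w) - u x))\<^sup>2" if "\<rho> \<ge> r" "norm w = 1" for \<rho> w
      using that r by simp
    have "continuous_on (cbox (r, 0, 0) (2*r, pi, 2*pi)) (\<lambda>(\<rho>, \<theta>, \<phi>). sin \<theta> * (sph \<theta> \<phi> \<bullet> (u (x + \<rho> *\<^sub>R sph \<theta> \<phi>) - u x))\<^sup>2)"
      unfolding case_prod_unfold by (intro cont)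
    then have "continuous_on (cbox (r, 0, 0) (2*r, pi, 2*pi)) (\<lambda>(\<rho>, \<theta>, \<phi>). sin \<theta> * (\<rho>\<^sup>2 * ?f (x + \<rho> *\<^sub>R sph \<theta> \<phi>)))"
      \<comment> \<open>Simplifying \<open>x + \<rho> w - x\<close> is suppressed so that the
        left-hand side of \<open>f\<close> still matches.\<close>
      by (rule continuous_on_eq) (auto simp: f cbox_triple simp del: add_diff_cancel_left')
    then have "integral {y. r \<le> norm (y - x) \<and> norm (y - x) \<le> 2 * r} ?f = integral {r..2*r} (\<lambda>\<rho>. sint (\<lambda>w. \<rho>\<^sup>2 * ?f (x + \<rho> *\<^sub>R w)))"
      using r by (intro integral_polar) auto
    also have "\<dots> = integral {r..2*r} Q"
      unfolding Q_def by (intro integral_cong sint_cong f) auto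
    finally show ?thesis .
  qed
  have ball: "integral {y. norm (x - y) \<le> 2 * r}
        (\<lambda>y. \<Sum>i\<in>UNIV. \<Sum>j\<in>UNIV. wgt (norm (y - x) / r) * sigma i j (hat (x - y)) / norm (x - y) ^ 3
              * (u y $ i - u x $ i) * (u y $ j - u x $ j)) = integral {0..2*r} (\<lambda>\<rho>. wgt (\<rho> / r) * k \<rho>)"
    (is "integral _ ?f = _")
  proof -
    have f: "\<rho>\<^sup>2 * ?f (x + \<rho> *\<^sub>R w) = wgt (\<rho> / r) * (3 * (w \<bullet> (u (x + \<rho> *\<^sub>R w) - u x))\<^sup>2 - (norm (u (x + \<rho> *\<^sub>R w) - u x))\<^sup>2) / \<rho>"
      if "\<rho> \<ge> 0" "norm w = 1" for \<rho> w
    \<comment> \<open>At \<open>\<rho> = 0\<close> both sides are 0, the left by the factor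
      \<open>\<rho>\<^sup>2\<close> and the right by \<open>a / 0 = 0\<close>. Otherwise the
      Jacobian reduces the inverse cube to \<open>1 / \<rho>\<close>.\<close>
    proof (cases "\<rho> = 0")
      case False
      let ?v = "u (x + \<rho> *\<^sub>R w) - u x"
      \<comment> \<open>The kernel uses \<open>x - y\<close>, hence the sign; it disappears in the
        square.\<close>
      have "hat (x - (x + \<rho> *\<^sub>R w)) = - w"
        using that False by (simp add: hat_def)
      then have "?f (x + \<rho> *\<^sub>R w) = wgt (\<rho> / r) * (3 * (w \<bullet> ?v)\<^sup>2 - (norm ?v)\<^sup>2) / \<rho> ^ 3"
        using sum_sigma_quadratic[of "wgt (\<rho> / r)" "- w" "\<rho> ^ 3" ?v] that by simp
      with False show ?thesis
        by (simp add: power2_eq_square power3_eq_cube)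
    qed simp
    have "continuous_on (cbox (0, 0, 0) (2*r, pi, 2*pi)) (\<lambda>(\<rho>, \<theta>, \<phi>). sin \<theta> * (\<rho>\<^sup>2 * ?f (x + \<rho> *\<^sub>R sph \<theta> \<phi>)))"
    proof (rule continuous_on_eq)
      show "continuous_on (cbox (0, 0, 0) (2*r, pi, 2*pi)) (\<lambda>(\<rho>, \<theta>, \<phi>). sin \<theta> *
          (wgt (\<rho> / r) * (3 * (sph \<theta> \<phi> \<bullet> (u (x + \<rho> *\<^sub>R sph \<theta> \<phi>) - u x))\<^sup>2
            - (norm (u (x + \<rho> *\<^sub>R sph \<theta> \<phi>) - u x))\<^sup>2) / \<rho>))"
        by (rule continuous_on_singular_kernel[OF C1_deriv_continuous[OF u continuous_on_id] C1_derivD[OF u] r])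
      fix z assume "z \<in> cbox (0, 0, 0) (2*r, pi, 2*pi)"
      then obtain \<rho> \<theta> \<phi> where z: "z = (\<rho>, \<theta>, \<phi>)" and \<rho>: "\<rho> \<ge> 0"
        by (auto simp: cbox_triple)
      show "(case z of (\<rho>, \<theta>, \<phi>) \<Rightarrow> sin \<theta> *
          (wgt (\<rho> / r) * (3 * (sph \<theta> \<phi> \<bullet> (u (x + \<rho> *\<^sub>R sph \<theta> \<phi>) - u x))\<^sup>2
            - (norm (u (x + \<rho> *\<^sub>R sph \<theta> \<phi>) - u x))\<^sup>2) / \<rho>)) =
        (case z of (\<rho>, \<theta>, \<phi>) \<Rightarrow> sin \<theta> * (\<rho>\<^sup>2 * ?f (x + \<rho> *\<^sub>R sph \<theta> \<phi>)))"
        unfolding z prod.case f[OF \<rho> norm_sph] ..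
    qed
    then have "integral {y. 0 \<le> norm (y - x) \<and> norm (y - x) \<le> 2 * r} ?f = integral {0..2*r} (\<lambda>\<rho>. sint (\<lambda>w. \<rho>\<^sup>2 * ?f (x + \<rho> *\<^sub>R w)))"
      by (intro integral_polar) auto
    also have "\<dots> = integral {0..2*r} (\<lambda>\<rho>. wgt (\<rho> / r) * k \<rho>)"
    proof (rule integral_cong)
      fix \<rho> assume "\<rho> \<in> {0..2*r}"
      then have "sint (\<lambda>w. \<rho>\<^sup>2 * ?f (x + \<rho> *\<^sub>R w)) = sint (\<lambda>w. (wgt (\<rho> / r) / \<rho>) * (3 * (w \<bullet> (u (x + \<rho> *\<^sub>R w) - u x))\<^sup>2 - (norm (u (x + \<rho> *\<^sub>R w) - u x))\<^sup>2))"
        by (intro sint_cong, subst f) auto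
      then show "sint (\<lambda>w. \<rho>\<^sup>2 * ?f (x + \<rho> *\<^sub>R w)) = wgt (\<rho> / r) * k \<rho>"
        unfolding sint_cmult k_def by simp
    qed
    finally show ?thesis
      by (simp add: norm_minus_commute)
  qed
  show "p x = beta p x r + piterm u x r"
    \<comment> \<open>The shell integral cancels the \<open>Q\<close> part of \<open>W\<close> and
      \<open>beta\<close> cancels the \<open>P\<close> part, leaving \<open>p x\<close>.\<close>
    unfolding piterm_def shell ball beta W using r by (simp add: field_simps)
qed

end
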